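(* For each positive integer $\nu$ let $T_\nu=\mathrm{span}\{1,\cos(m\theta),\sin(m\theta):1\le m\le\nu\}\subset C^\infty(S^1)$, where $S^1=\mathbb R/2\pi\mathbb Z$, and let $\mu(S^1,T_\nu)$ be the expected number of critical points of a random function in $T_\nu$. Then $$\mu(S^1,T_\nu)\sim2\nu\sqrt{\tfrac35}\sim\sqrt{\tfrac35}\,\dim T_\nu\qquad\text{as }\nu\to\infty .$$
   Context: $T_\nu$ is equipped with the inner product $(u,v)=\int_0^{2\pi}u(\theta)v(\theta)\,d\theta$, and $\mu(S^1,T_\nu)=\frac1{\mathrm{area}(S)}\int_S\mu(v)\,|dS(v)|$, where $S$ is the unit sphere of $T_\nu$ and $\mu(v)$ is the number of critical points of $v:S^1\to\mathbb R$. $a_\nu\sim b_\nu$ means $a_\nu/b_\nu\to1$. *)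

theory Defs
  imports "HOL-Analysis.Analysis" "HOL-Library.Function_Algebras" "HOL-Library.Landau_Symbols"
begin

text \<open>Functions on the circle \<open>\<real>/2\<pi>\<int>\<close> are \<open>2\<pi>\<close>-periodic functions on \<open>\<real>\<close>, and \<open>{0..<2\<pi>}\<close>
  serves as a set of representatives for the points of the circle.\<close>

global_interpretation fun_space: vector_space "\<lambda>(c::real) (f::real \<Rightarrow> real). (\<lambda>\<theta>. c * f \<theta>)"
  by standard (auto simp: algebra_simps)

definition trig_space :: "nat \<Rightarrow> (real \<Rightarrow> real) set" where
  "trig_space \<nu> = fun_space.span ({\<lambda>\<theta>. 1}
     \<union> {(\<lambda>\<theta>. cos (real m * \<theta>)) | m. 1 \<le> m \<and> m \<le> \<nu>}
     \<union> {(\<lambda>\<theta>. sin (real m * \<theta>)) | m. 1 \<le> m \<and> m \<le> \<nu>})"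

definition circle_inner :: "(real \<Rightarrow> real) \<Rightarrow> (real \<Rightarrow> real) \<Rightarrow> real" where
  "circle_inner u v = integral {0..2*pi} (\<lambda>\<theta>. u \<theta> * v \<theta>)"

definition circle_norm :: "(real \<Rightarrow> real) \<Rightarrow> real" where
  "circle_norm v = sqrt (circle_inner v v)"

definition unit_sphere :: "nat \<Rightarrow> (real \<Rightarrow> real) set" where
  "unit_sphere \<nu> = {v \<in> trig_space \<nu>. circle_norm v = 1}"

definition critical_points :: "(real \<Rightarrow> real) \<Rightarrow> real set" where
  "critical_points v = {\<theta> \<in> {0..<2*pi}. (v has_real_derivative 0) (at \<theta>)}"

text \<open>The number of critical points is \<open>\<infinity>\<close> (not \<open>0\<close>) when there are infinitely many.\<close>

definition num_critical_points :: "(real \<Rightarrow> real) \<Rightarrow> ennreal" where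
  "num_critical_points v = emeasure (count_space UNIV) (critical_points v)"

text \<open>An orthonormal basis of \<open>trig_space \<nu>\<close>, indexed by \<open>{-\<nu>..\<nu>}\<close>; see
  \<open>trig_basis_orthonormal\<close> and \<open>span_trig_basis\<close> below.\<close>

definition trig_basis :: "int \<Rightarrow> real \<Rightarrow> real" where
  "trig_basis k \<theta> =
     (if k = 0 then 1 / sqrt (2*pi)
      else if k > 0 then cos (of_int k * \<theta>) / sqrt pi
      else sin (of_int (-k) * \<theta>) / sqrt pi)"

text \<open>On a finite-dimensional space of functions the Borel sets are those generated by the
  evaluations \<open>v \<mapsto> v \<theta>\<close>.\<close>

definition function_borel :: "(real \<Rightarrow> real) set \<Rightarrow> (real \<Rightarrow> real) measure" where
  "function_borel X = restrict_space (\<Pi>\<^sub>M \<theta>\<in>UNIV. borel) X"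

text \<open>Lebesgue measure of the Euclidean space \<open>trig_space \<nu>\<close>: the image of the product Lebesgue
  measure under coordinates with respect to an orthonormal basis.\<close>

definition trig_volume :: "nat \<Rightarrow> (real \<Rightarrow> real) measure" where
  "trig_volume \<nu> =
     distr (\<Pi>\<^sub>M k\<in>{- int \<nu>..int \<nu>}. lborel) (function_borel (trig_space \<nu>))
       (\<lambda>a \<theta>. \<Sum>k\<in>{- int \<nu>..int \<nu>}. a k * trig_basis k \<theta>)"

text \<open>The area measure \<open>|dS|\<close> of the unit sphere in dimension \<open>n\<close>, given by integration in polar
  coordinates \<open>dv = r\<^sup>n\<^sup>-\<^sup>1 dr |dS|\<close>: the area of \<open>A\<close> is \<open>n\<close> times the volume of the cone
  \<open>{t u | 0 < t \<le> 1, u \<in> A}\<close>, see \<open>emeasure_sphere_area\<close> below.\<close>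

definition sphere_area :: "nat \<Rightarrow> (real \<Rightarrow> real) measure" where
  "sphere_area \<nu> =
     scale_measure (of_nat (fun_space.dim (trig_space \<nu>)))
       (distr (restrict_space (trig_volume \<nu>) {v. 0 < circle_norm v \<and> circle_norm v \<le> 1})
          (function_borel (unit_sphere \<nu>)) (\<lambda>v \<theta>. v \<theta> / circle_norm v))"

definition expected_critical_points :: "nat \<Rightarrow> ennreal" where
  "expected_critical_points \<nu> =
     (\<integral>\<^sup>+ v. num_critical_points v \<partial>sphere_area \<nu>) / emeasure (sphere_area \<nu>) (unit_sphere \<nu>)"


lemma has_integral_cos_period:
  "((\<lambda>\<theta>. cos (of_int k * \<theta>)) has_integral (if k = 0 then 2*pi else 0)) {0..2*pi}"
proof (cases "k = 0")
  case True
  then show ?thesis using has_integral_const_real[of "1::real" 0 "2*pi"] by simp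
next
  case False
  have "((\<lambda>\<theta>. cos (of_int k * \<theta>)) has_integral
      (sin (of_int k * (2*pi)) / of_int k - sin (of_int k * 0) / of_int k)) {0..2*pi}"
    using False
    by (intro fundamental_theorem_of_calculus)
       (auto intro!: derivative_eq_intros simp flip: has_real_derivative_iff_has_vector_derivative)
  moreover have "sin (of_int k * (2*pi)) = 0"
    using sin_int_2pin[of k] by (simp add: mult.commute mult.left_commute)
  ultimately show ?thesis using False by simp
qed

lemma has_integral_sin_period:
  "((\<lambda>\<theta>. sin (of_int k * \<theta>)) has_integral 0) {0..2*pi}"
proof (cases "k = 0")
  case True
  then show ?thesis by simp
next
  case False
  have "((\<lambda>\<theta>. sin (of_int k * \<theta>)) has_integral
      (- cos (of_int k * (2*pi)) / of_int k - (- cos (of_int k * 0) / of_int k))) {0..2*pi}"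
    using False
    by (intro fundamental_theorem_of_calculus)
       (auto intro!: derivative_eq_intros simp flip: has_real_derivative_iff_has_vector_derivative)
  moreover have "cos (of_int k * (2*pi)) = 1"
    using cos_int_2pin[of k] by (simp add: mult.commute mult.left_commute)
  ultimately show ?thesis using False by simp
qed

lemma integral_cos_cos:
  "((\<lambda>\<theta>. cos (of_int j * \<theta>) * cos (of_int k * \<theta>)) has_integral
     ((if j = k then pi else 0) + (if j = - k then pi else 0))) {0..2*pi}"
proof -
  have "((\<lambda>\<theta>. (cos (of_int (j-k) * \<theta>) + cos (of_int (j+k) * \<theta>)) / 2) has_integral
     (((if j-k = 0 then 2*pi else 0) + (if j+k = 0 then 2*pi else 0)) / 2)) {0..2*pi}"
    by (intro has_integral_divide has_integral_add has_integral_cos_period)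
  then show ?thesis
    by (rule has_integral_eq_rhs[OF has_integral_eq, rotated])
       (auto simp: cos_times_cos algebra_simps)
qed

lemma integral_sin_sin:
  "((\<lambda>\<theta>. sin (of_int j * \<theta>) * sin (of_int k * \<theta>)) has_integral
     ((if j = k then pi else 0) - (if j = - k then pi else 0))) {0..2*pi}"
proof -
  have "((\<lambda>\<theta>. (cos (of_int (j-k) * \<theta>) - cos (of_int (j+k) * \<theta>)) / 2) has_integral
     (((if j-k = 0 then 2*pi else 0) - (if j+k = 0 then 2*pi else 0)) / 2)) {0..2*pi}"
    by (intro has_integral_divide has_integral_diff has_integral_cos_period)
  then show ?thesis
    by (rule has_integral_eq_rhs[OF has_integral_eq, rotated])
       (auto simp: sin_times_sin algebra_simps)
qed

lemma integral_sin_cos: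
  "((\<lambda>\<theta>. sin (of_int j * \<theta>) * cos (of_int k * \<theta>)) has_integral 0) {0..2*pi}"
proof -
  have "((\<lambda>\<theta>. (sin (of_int (j+k) * \<theta>) + sin (of_int (j-k) * \<theta>)) / 2) has_integral
     ((0 + 0) / 2)) {0..2*pi}"
    by (intro has_integral_divide has_integral_add has_integral_sin_period)
  then show ?thesis
    by (rule has_integral_eq_rhs[OF has_integral_eq, rotated])
       (simp_all add: sin_times_cos distrib_right left_diff_distrib)
qed

lemma trig_basis_orthonormal:
  "circle_inner (trig_basis j) (trig_basis k) = (if j = k then 1 else 0)"
proof -
  have eqs: "trig_basis 0 = (\<lambda>\<theta>. 1 / sqrt (2*pi))"
    "\<And>k. k > 0 \<Longrightarrow> trig_basis k = (\<lambda>\<theta>. cos (of_int k * \<theta>) / sqrt pi)"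
    "\<And>k. k < 0 \<Longrightarrow> trig_basis k = (\<lambda>\<theta>. sin (of_int (-k) * \<theta>) / sqrt pi)"
    by (auto simp: trig_basis_def fun_eq_iff)
  have s2: "sqrt (2*pi) * sqrt (2*pi) = 2*pi" "sqrt pi * sqrt pi = pi" by simp_all
  have I: "circle_inner u v = z" if "((\<lambda>\<theta>. u \<theta> * v \<theta>) has_integral z) {0..2*pi}" for u v z
    using that unfolding circle_inner_def by (rule integral_unique)
  have comm: "circle_inner u v = circle_inner v u" for u v
    by (simp add: circle_inner_def mult.commute)
  have c: "circle_inner (trig_basis 0) (trig_basis 0) = 1"
    using has_integral_divide[OF has_integral_cos_period[of 0], of "2*pi"]
    by (intro I) (simp add: eqs s2)
  have cc: "circle_inner (trig_basis 0) (trig_basis k) = 0" if "k > 0" for k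
    using has_integral_divide[OF has_integral_cos_period[of k], of "sqrt (2*pi) * sqrt pi"] that
    by (intro I) (simp add: eqs)
  have cs: "circle_inner (trig_basis 0) (trig_basis k) = 0" if "k < 0" for k
    using has_integral_divide[OF has_integral_sin_period[of "-k"], of "sqrt (2*pi) * sqrt pi"] that
    by (intro I) (simp add: eqs)
  have coco: "circle_inner (trig_basis j) (trig_basis k) = (if j = k then 1 else 0)"
    if "j > 0" "k > 0" for j k
    using has_integral_divide[OF integral_cos_cos[of j k], of "pi"] that
    by (intro I) (cases "j = k"; simp add: eqs s2)
  have sisi: "circle_inner (trig_basis j) (trig_basis k) = (if j = k then 1 else 0)"
    if "j < 0" "k < 0" for j k
    using has_integral_divide[OF integral_sin_sin[of "-j" "-k"], of "pi"] that
    by (intro I) (cases "j = k"; simp add: eqs s2)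
  have sico: "circle_inner (trig_basis j) (trig_basis k) = 0" if "j < 0" "k > 0" for j k
    using has_integral_divide[OF integral_sin_cos[of "-j" k], of "pi"] that
    by (intro I) (simp add: eqs s2)
  show ?thesis
    using c cc cs coco sisi sico comm
    by (metis linorder_neqE_linordered_idom less_irrefl)
qed

lemma span_trig_basis:
  "fun_space.span (trig_basis ` {- int \<nu>..int \<nu>}) = trig_space \<nu>"
proof -
  let ?S = "{\<lambda>\<theta>. 1} \<union> {(\<lambda>\<theta>. cos (real m * \<theta>)) | m. 1 \<le> m \<and> m \<le> \<nu>}
     \<union> {(\<lambda>\<theta>. sin (real m * \<theta>)) | m. 1 \<le> m \<and> m \<le> \<nu>}"
  let ?B = "trig_basis ` {- int \<nu>..int \<nu>}"
  have 1: "trig_basis k \<in> fun_space.span ?S" if "- int \<nu> \<le> k" "k \<le> int \<nu>" for k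
  proof -
    consider "k = 0" | "k > 0" | "k < 0" by linarith
    then show ?thesis
    proof cases
      case 1
      have "(\<lambda>\<theta>. (1 / sqrt (2*pi)) * 1) \<in> fun_space.span ?S"
        by (rule fun_space.span_scale[of "\<lambda>\<theta>. 1"]) (auto intro: fun_space.span_base)
      moreover have "trig_basis k = (\<lambda>\<theta>. (1 / sqrt (2*pi)) * 1)"
        using 1 by (auto simp: trig_basis_def fun_eq_iff)
      ultimately show ?thesis by simp
    next
      case 2
      have "(\<lambda>\<theta>. (1 / sqrt pi) * cos (real (nat k) * \<theta>)) \<in> fun_space.span ?S"
        using 2 that by (intro fun_space.span_scale[of "\<lambda>\<theta>. cos (real (nat k) * \<theta>)"]
            fun_space.span_base) (auto intro!: exI[of _ "nat k"])
      moreover have "trig_basis k = (\<lambda>\<theta>. (1 / sqrt pi) * cos (real (nat k) * \<theta>))"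
        using 2 by (auto simp: trig_basis_def fun_eq_iff)
      ultimately show ?thesis by simp
    next
      case 3
      have "(\<lambda>\<theta>. (1 / sqrt pi) * sin (real (nat (-k)) * \<theta>)) \<in> fun_space.span ?S"
        using 3 that by (intro fun_space.span_scale[of "\<lambda>\<theta>. sin (real (nat (-k)) * \<theta>)"]
            fun_space.span_base) (auto intro!: exI[of _ "nat (-k)"])
      moreover have "trig_basis k = (\<lambda>\<theta>. (1 / sqrt pi) * sin (real (nat (-k)) * \<theta>))"
        using 3 by (auto simp: trig_basis_def fun_eq_iff)
      ultimately show ?thesis by simp
    qed
  qed
  have one: "(\<lambda>\<theta>. 1) \<in> fun_space.span ?B"
  proof -
    have "(\<lambda>\<theta>. sqrt (2*pi) * trig_basis 0 \<theta>) \<in> fun_space.span ?B"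
      by (intro fun_space.span_scale fun_space.span_base) auto
    then show ?thesis by (simp add: trig_basis_def)
  qed
  have co: "(\<lambda>\<theta>. cos (real m * \<theta>)) \<in> fun_space.span ?B" if "1 \<le> m" "m \<le> \<nu>" for m
  proof -
    have "(\<lambda>\<theta>. sqrt pi * trig_basis (int m) \<theta>) \<in> fun_space.span ?B"
      using that by (intro fun_space.span_scale fun_space.span_base) auto
    then show ?thesis using that by (simp add: trig_basis_def)
  qed
  have si: "(\<lambda>\<theta>. sin (real m * \<theta>)) \<in> fun_space.span ?B" if "1 \<le> m" "m \<le> \<nu>" for m
  proof -
    have "(\<lambda>\<theta>. sqrt pi * trig_basis (- int m) \<theta>) \<in> fun_space.span ?B"
      using that by (intro fun_space.span_scale fun_space.span_base) auto
    then show ?thesis using that by (simp add: trig_basis_def)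
  qed
  have "fun_space.span ?B \<subseteq> fun_space.span ?S"
    using 1 by (intro fun_space.span_minimal) auto
  moreover have "fun_space.span ?S \<subseteq> fun_space.span ?B"
    using one co si by (intro fun_space.span_minimal) auto
  ultimately show ?thesis by (simp add: trig_space_def)
qed

lemma sum_fun_apply: "(\<Sum>i\<in>I. f i) x = (\<Sum>i\<in>I. f i x)" for f :: "'i \<Rightarrow> 'x \<Rightarrow> real"
  by (induction I rule: infinite_finite_induct) auto

lemma trig_synthesis_in_trig_space:
  "(\<lambda>\<theta>. \<Sum>k\<in>{- int \<nu>..int \<nu>}. a k * trig_basis k \<theta>) \<in> trig_space \<nu>"
proof -
  have "(\<Sum>k\<in>{- int \<nu>..int \<nu>}. (\<lambda>\<theta>. a k * trig_basis k \<theta>)) \<in> trig_space \<nu>"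
    unfolding span_trig_basis[symmetric]
    by (intro fun_space.span_sum fun_space.span_scale fun_space.span_base) auto
  moreover have "(\<Sum>k\<in>{- int \<nu>..int \<nu>}. (\<lambda>\<theta>. a k * trig_basis k \<theta>))
      = (\<lambda>\<theta>. \<Sum>k\<in>{- int \<nu>..int \<nu>}. a k * trig_basis k \<theta>)"
    by (simp add: sum_fun_apply fun_eq_iff)
  ultimately show ?thesis by (simp only:)
qed

lemma continuous_on_trig_basis: "continuous_on A (trig_basis k)"
proof -
  consider "k = 0" | "k > 0" | "k < 0" by linarith
  then show ?thesis
    by cases (auto simp: trig_basis_def[abs_def] intro!: continuous_intros)
qed

lemma continuous_on_trig_space:
  assumes "v \<in> trig_space \<nu>"
  shows "continuous_on A v"
proof -
  have "fun_space.span (trig_basis ` {- int \<nu>..int \<nu>}) \<subseteq> {v. continuous_on A v}"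
    by (intro fun_space.span_minimal fun_space.subspaceI)
       (auto intro!: continuous_intros continuous_on_trig_basis simp: zero_fun_def plus_fun_def)
  then show ?thesis using assms by (auto simp: span_trig_basis)
qed

lemma dim_trig_space: "fun_space.dim (trig_space \<nu>) = 2 * \<nu> + 1"
proof -
  let ?I = "{- int \<nu>..int \<nu>}"
  let ?B = "trig_basis ` ?I"
  have inj: "inj_on trig_basis ?I"
    by (rule inj_onI) (metis trig_basis_orthonormal zero_neq_one)
  have coeff: "f u = 0"
    if 0: "(\<Sum>x\<in>?B. (\<lambda>\<theta>. f x * x \<theta>)) = 0" and u: "u \<in> ?B" for f u
  proof -
    from u obtain j where j: "j \<in> ?I" "u = trig_basis j" by auto
    have pt: "(\<Sum>k\<in>?I. f (trig_basis k) * trig_basis k \<theta>) = 0" for \<theta>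
      using fun_cong[OF 0, of \<theta>] by (simp add: sum_fun_apply sum.reindex[OF inj])
    have int: "(\<lambda>\<theta>. trig_basis k \<theta> * trig_basis j \<theta>) integrable_on {0..2*pi}" for k
      by (intro integrable_continuous_real continuous_intros continuous_on_trig_basis)
    have "0 = integral {0..2*pi}
        (\<lambda>\<theta>. (\<Sum>k\<in>?I. f (trig_basis k) * trig_basis k \<theta>) * trig_basis j \<theta>)"
      by (simp add: pt)
    also have "\<dots> = integral {0..2*pi}
        (\<lambda>\<theta>. \<Sum>k\<in>?I. f (trig_basis k) * (trig_basis k \<theta> * trig_basis j \<theta>))"
      by (simp add: sum_distrib_right mult.assoc)
    also have "\<dots> = (\<Sum>k\<in>?I. f (trig_basis k) * circle_inner (trig_basis k) (trig_basis j))"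
      by (subst integral_sum)
         (auto simp: circle_inner_def intro!: integrable_on_mult_right int)
    also have "\<dots> = f u"
      using j by (simp add: trig_basis_orthonormal if_distrib[of "\<lambda>x. _ * x"] cong: if_cong)
    finally show "f u = 0" by simp
  qed
  have "fun_space.independent ?B"
  proof
    assume "fun_space.dependent ?B"
    then obtain t g v where t: "finite t" "t \<subseteq> ?B" "(\<Sum>v\<in>t. (\<lambda>\<theta>. g v * v \<theta>)) = 0" "v \<in> t"
      and g: "g v \<noteq> 0"
      unfolding fun_space.dependent_explicit by blast
    define h where "h = (\<lambda>w. if w \<in> t then g w else 0)"
    have "(\<Sum>x\<in>?B. (\<lambda>\<theta>. h x * x \<theta>)) = (\<Sum>x\<in>t. (\<lambda>\<theta>. g x * x \<theta>))"
      using t(1,2) by (intro sum.mono_neutral_cong_right) (auto simp: zero_fun_def h_def)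
    with t(3) have "(\<Sum>x\<in>?B. (\<lambda>\<theta>. h x * x \<theta>)) = 0" by (rule trans[rotated])
    from coeff[of h v, OF this subsetD[OF t(2,4)]] show False
      using g t(4) by (simp add: h_def)
  qed
  then have "fun_space.dim (fun_space.span ?B) = card ?B"
    by (rule fun_space.dim_span_eq_card_independent)
  also have "card ?B = 2 * \<nu> + 1"
    by (simp add: card_image[OF inj])
  finally show ?thesis by (simp only: span_trig_basis)
qed

lemma space_function_borel [simp]: "space (function_borel X) = X"
  by (simp add: function_borel_def space_restrict_space space_PiM)

lemma measurable_eval: "(\<lambda>v. v \<theta>) \<in> borel_measurable (function_borel X)"
  unfolding function_borel_def by (intro measurable_restrict_space1) simp

lemma measurable_function_borelI:
  assumes "\<And>\<theta>. (\<lambda>x. f x \<theta>) \<in> borel_measurable M" and "\<And>x. x \<in> space M \<Longrightarrow> f x \<in> X"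
  shows "f \<in> M \<rightarrow>\<^sub>M function_borel X"
  unfolding function_borel_def
  by (intro measurable_restrict_space2 measurable_PiM_single') (use assms in \<open>auto simp: space_PiM\<close>)

lemma measurable_trig_synthesis:
  "(\<lambda>a \<theta>. \<Sum>k\<in>{- int \<nu>..int \<nu>}. a k * trig_basis k \<theta>)
     \<in> (\<Pi>\<^sub>M k\<in>{- int \<nu>..int \<nu>}. lborel) \<rightarrow>\<^sub>M function_borel (trig_space \<nu>)"
proof (rule measurable_function_borelI)
  fix \<theta>
  show "(\<lambda>a. \<Sum>k\<in>{- int \<nu>..int \<nu>}. a k * trig_basis k \<theta>)
      \<in> borel_measurable (\<Pi>\<^sub>M k\<in>{- int \<nu>..int \<nu>}. lborel)"
    by measurable
qed (rule trig_synthesis_in_trig_space)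

lemma measurable_eval_joint:
  "(\<lambda>(v, \<theta>). v \<theta>) \<in> borel_measurable (function_borel (trig_space \<nu>) \<Otimes>\<^sub>M lborel)"
proof (rule borel_measurable_LIMSEQ_real
    [where u = "\<lambda>n (v, \<theta>). v (of_int \<lfloor>\<theta> * (real n + 1)\<rfloor> / (real n + 1))"])
  fix n :: nat
  have "(\<lambda>p. (\<lambda>i p. fst p (of_int i / (real n + 1))) \<lfloor>snd p * (real n + 1)\<rfloor> p)
    \<in> borel_measurable (function_borel (trig_space \<nu>) \<Otimes>\<^sub>M lborel)"
  proof (rule measurable_compose_countable
      [where f = "\<lambda>i p. fst p (of_int i / (real n + 1))" and g = "\<lambda>p. \<lfloor>snd p * (real n + 1)\<rfloor>"])
    show "(\<lambda>p. fst p (of_int i / (real n + 1)))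
        \<in> borel_measurable (function_borel (trig_space \<nu>) \<Otimes>\<^sub>M lborel)" for i :: int
      by (rule measurable_compose[OF measurable_fst measurable_eval])
  qed measurable
  then show "(\<lambda>(v, \<theta>). v (of_int \<lfloor>\<theta> * (real n + 1)\<rfloor> / (real n + 1)))
    \<in> borel_measurable (function_borel (trig_space \<nu>) \<Otimes>\<^sub>M lborel)"
    by (simp add: case_prod_beta)
next
  fix p assume "p \<in> space (function_borel (trig_space \<nu>) \<Otimes>\<^sub>M (lborel :: real measure))"
  then obtain v \<theta> where p: "p = (v, \<theta>)" "v \<in> trig_space \<nu>"
    by (auto simp: space_pair_measure)
  have "(\<lambda>n. of_int \<lfloor>\<theta> * (real n + 1)\<rfloor> / (real n + 1)) \<longlonglongrightarrow> \<theta>"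
  proof (rule tendsto_sandwich)
    have lo: "\<theta> - 1 / x \<le> of_int \<lfloor>\<theta> * x\<rfloor> / x" if "x > 0" for x :: real
    proof -
      have "(\<theta> * x - 1) / x \<le> of_int \<lfloor>\<theta> * x\<rfloor> / x"
        by (rule divide_right_mono) (use that in linarith)+
      then show ?thesis using that by (simp add: diff_divide_distrib)
    qed
    have hi: "of_int \<lfloor>\<theta> * x\<rfloor> / x \<le> \<theta>" if "x > 0" for x :: real
      using that by (simp add: pos_divide_le_eq)
    show "\<forall>\<^sub>F n in sequentially. \<theta> - 1 / (real n + 1) \<le> of_int \<lfloor>\<theta> * (real n + 1)\<rfloor> / (real n + 1)"
      by (intro always_eventually allI lo) simp
    show "\<forall>\<^sub>F n in sequentially. of_int \<lfloor>\<theta> * (real n + 1)\<rfloor> / (real n + 1) \<le> \<theta>"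
      by (intro always_eventually allI hi) simp
    show "(\<lambda>n. \<theta> - 1 / (real n + 1)) \<longlonglongrightarrow> \<theta>"
      using tendsto_diff[OF tendsto_const[of \<theta>] LIMSEQ_inverse_real_of_nat]
      by (simp add: inverse_eq_divide add.commute)
  qed simp
  moreover have "isCont v \<theta>"
    using continuous_on_trig_space[OF p(2), of UNIV] by (simp add: continuous_on_eq_continuous_at)
  ultimately show "(\<lambda>n. (\<lambda>(v, \<theta>). v (of_int \<lfloor>\<theta> * (real n + 1)\<rfloor> / (real n + 1))) p)
      \<longlonglongrightarrow> (\<lambda>(v, \<theta>). v \<theta>) p"
    unfolding p prod.case by (rule isCont_tendsto_compose[rotated])
qed

lemma measurable_circle_norm: "circle_norm \<in> borel_measurable (function_borel (trig_space \<nu>))"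
proof -
  have eq: "circle_norm v = sqrt (LINT \<theta>|lborel. indicator {0..2*pi} \<theta> * (v \<theta> * v \<theta>))"
    if "v \<in> trig_space \<nu>" for v
  proof -
    have "continuous_on {0..2*pi} (\<lambda>\<theta>. v \<theta> * v \<theta>)"
      using continuous_on_trig_space[OF that] by (intro continuous_intros)
    then have "set_integrable lborel {0..2*pi} (\<lambda>\<theta>. v \<theta> * v \<theta>)"
      by (rule borel_integrable_atLeastAtMost')
    from set_borel_integral_eq_integral(2)[OF this] show ?thesis
      by (simp add: circle_norm_def circle_inner_def set_lebesgue_integral_def)
  qed
  have "(\<lambda>v. sqrt (LINT \<theta>|lborel. indicator {0..2*pi} \<theta> * (v \<theta> * v \<theta>)))
      \<in> borel_measurable (function_borel (trig_space \<nu>))"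
    using measurable_eval_joint[of \<nu>]
    by (intro measurable_compose[OF _ borel_measurable_sqrt] lborel.borel_measurable_lebesgue_integral)
       (simp add: case_prod_beta)
  then show ?thesis
    by (subst measurable_cong[where g = "\<lambda>v. sqrt (LINT \<theta>|lborel. indicator {0..2*pi} \<theta> * (v \<theta> * v \<theta>))"])
       (auto simp: eq)
qed

lemma trig_space_scale:
  "v \<in> trig_space \<nu> \<Longrightarrow> (\<lambda>\<theta>. c * v \<theta>) \<in> trig_space \<nu>"
  unfolding trig_space_def by (rule fun_space.span_scale[of v _ c])

lemma circle_norm_scale: "circle_norm (\<lambda>\<theta>. c * v \<theta>) = \<bar>c\<bar> * circle_norm v"
proof -
  have sq: "(c * v \<theta>) * (c * v \<theta>) = c\<^sup>2 * (v \<theta> * v \<theta>)" for \<theta>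
    unfolding power2_eq_square by (simp only: mult_ac)
  have "circle_inner (\<lambda>\<theta>. c * v \<theta>) (\<lambda>\<theta>. c * v \<theta>) = c\<^sup>2 * circle_inner v v"
    unfolding circle_inner_def sq by (rule integral_mult_right)
  then show ?thesis
    unfolding circle_norm_def by (simp only: real_sqrt_mult real_sqrt_abs)
qed

lemma emeasure_sphere_area:
  assumes A: "A \<in> sets (function_borel (unit_sphere \<nu>))"
  shows "emeasure (sphere_area \<nu>) A = of_nat (fun_space.dim (trig_space \<nu>)) *
    emeasure (trig_volume \<nu>) {(\<lambda>\<theta>. t * u \<theta>) | t u. 0 < t \<and> t \<le> 1 \<and> u \<in> A}"
proof -
  let ?V = "trig_volume \<nu>" and ?D = "{v. 0 < circle_norm v \<and> circle_norm v \<le> 1}"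
  let ?N = "\<lambda>v (\<theta>::real). v \<theta> / circle_norm v"
  have sub: "A \<subseteq> unit_sphere \<nu>" using sets.sets_into_space[OF A] by simp
  have sV: "sets ?V = sets (function_borel (trig_space \<nu>))" and spV: "space ?V = trig_space \<nu>"
    by (simp_all add: trig_volume_def)
  note cn = measurable_circle_norm[of \<nu>, folded measurable_cong_sets[OF sV refl]]
  have D: "?D \<inter> space ?V \<in> sets ?V"
  proof -
    have "{v \<in> space ?V. 0 < circle_norm v \<and> circle_norm v \<le> 1} \<in> sets ?V"
      using cn by measurable
    then show ?thesis by (simp add: Int_def conj_commute)
  qed
  have N: "?N \<in> restrict_space ?V ?D \<rightarrow>\<^sub>M function_borel (unit_sphere \<nu>)"
  proof (rule measurable_function_borelI)
    fix \<theta>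
    have "(\<lambda>v. v \<theta>) \<in> borel_measurable ?V"
      using measurable_eval[of \<theta> "trig_space \<nu>"] by (simp add: measurable_cong_sets[OF sV refl])
    with cn show "(\<lambda>v. v \<theta> / circle_norm v) \<in> borel_measurable (restrict_space ?V ?D)"
      by (intro measurable_restrict_space1) simp
  next
    fix v assume "v \<in> space (restrict_space ?V ?D)"
    then have v: "v \<in> trig_space \<nu>" "0 < circle_norm v" by (auto simp: space_restrict_space spV)
    then show "?N v \<in> unit_sphere \<nu>"
      using trig_space_scale[OF v(1), of "1 / circle_norm v"]
        circle_norm_scale[of "1 / circle_norm v" v]
      by (simp add: unit_sphere_def)
  qed
  have cone: "?N -` A \<inter> space (restrict_space ?V ?D)
      = {(\<lambda>\<theta>. t * u \<theta>) | t u. 0 < t \<and> t \<le> 1 \<and> u \<in> A}" (is "?L = ?R")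
  proof (intro set_eqI iffI)
    fix v assume "v \<in> ?L"
    then have "?N v \<in> A" "0 < circle_norm v" "circle_norm v \<le> 1"
      by (auto simp: space_restrict_space)
    moreover from this have "v = (\<lambda>\<theta>. circle_norm v * ?N v \<theta>)" by auto
    ultimately show "v \<in> ?R" by (intro CollectI exI[of _ "circle_norm v"] exI[of _ "?N v"] conjI)
  next
    fix v assume "v \<in> ?R"
    then obtain t u where v: "v = (\<lambda>\<theta>. t * u \<theta>)" "0 < t" "t \<le> 1" "u \<in> A" by auto
    with sub have u: "u \<in> trig_space \<nu>" "circle_norm u = 1" by (auto simp: unit_sphere_def)
    have n: "circle_norm v = t" using v u by (simp add: circle_norm_scale)
    have "v \<in> trig_space \<nu>" unfolding v(1) by (rule trig_space_scale[OF u(1)])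
    moreover have "?N v = u" using v(2) unfolding n by (simp add: v(1))
    ultimately show "v \<in> ?L" using n v by (simp add: space_restrict_space spV)
  qed
  have "emeasure (distr (restrict_space ?V ?D) (function_borel (unit_sphere \<nu>)) ?N) A
      = emeasure ?V ?R"
  proof -
    have "emeasure (distr (restrict_space ?V ?D) (function_borel (unit_sphere \<nu>)) ?N) A
      = emeasure (restrict_space ?V ?D) (?N -` A \<inter> space (restrict_space ?V ?D))"
      by (rule emeasure_distr[OF N A])
    also have "\<dots> = emeasure ?V (?N -` A \<inter> space (restrict_space ?V ?D))"
      using D by (intro emeasure_restrict_space) (auto simp: space_restrict_space)
    finally show ?thesis unfolding cone .
  qed
  then show ?thesis by (simp add: sphere_area_def)
qed

end

theory Submission
  imports Defs "HOL-Real_Asymp.Real_Asymp"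
begin

text \<open>
The expected number of critical points has the closed form
\<open>2 sqrt ((\<Sum>m=1..\<nu>. m\<^sup>4) / (\<Sum>m=1..\<nu>. m\<^sup>2)) = 2 sqrt ((3 \<nu>\<^sup>2 + 3 \<nu> - 1) / 5)\<close> for \<open>\<nu> \<ge> 1\<close>
(\<open>expected_critical_points_eq\<close>, \<open>sum_fourth_powers_over_squares\<close>), from which both asymptotic
equivalences follow at once. The closed form is the formula of Kac and Rice for the zeros of the
derivative \<open>v'\<close>. It is obtained here by counting sign changes instead of zeros.

\<^bold>\<open>Sign changes.\<close> If \<open>v'\<close> has only simple zeros, none of them at a point \<open>2 \<pi> j / 2\<^sup>k\<close>, then
the number of sign changes of \<open>v'\<close> along the grid of these points with fixed \<open>k\<close> increases with
\<open>k\<close> to the number of zeros (\<open>SUP_sign_changes\<close>). Almost every \<open>v\<close> has these properties, by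
\<open>AE_not_grid_zero\<close> and \<open>AE_not_degenerate\<close>. Monotone convergence thus reduces the expected number
of critical points to the probability that \<open>v'\<close> has opposite signs at two neighbouring grid points.

\<^bold>\<open>Probability of one sign change.\<close> The value \<open>v'(\<theta>)\<close> is the inner product of the coefficient
vector of \<open>v\<close> with a vector \<open>\<gamma>(\<theta>)\<close> whose length does not depend on \<open>\<theta>\<close>. For a uniformly
distributed direction, the inner products with \<open>\<gamma>(\<alpha>)\<close> and \<open>\<gamma>(\<beta>)\<close> have opposite signs with
probability \<open>\<omega> / \<pi>\<close>, where \<open>\<omega>\<close> is the angle between the two vectors. Since these events do not
depend on the length of the coefficient vector, the probability is a quotient of volumes in the unit
ball, and the event is the sector \<open>\<bar>p \<bullet> a\<bar> < \<bar>q \<bullet> a\<bar>\<close> for the orthogonal vectors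
\<open>p = \<gamma>(\<alpha>) + \<gamma>(\<beta>)\<close> and \<open>q = \<gamma>(\<alpha>) - \<gamma>(\<beta>)\<close> (\<open>emeasure_sector\<close>). Rotations move \<open>p\<close> and
\<open>q\<close> to coordinate axes; that they preserve product Lebesgue measure follows from the factorisation
of a plane rotation into three shears.

\<^bold>\<open>Limit.\<close> With mesh \<open>h\<close> there are \<open>2 \<pi> / h\<close> grid intervals, and for \<open>h \<rightarrow> 0\<close> the angle is
asymptotic to \<open>h\<close> times the ratio of the lengths of \<open>\<gamma>'\<close> and \<open>\<gamma>\<close>. The squares of these lengths
are \<open>(\<Sum>m=1..\<nu>. m\<^sup>4) / \<pi>\<close> and \<open>(\<Sum>m=1..\<nu>. m\<^sup>2) / \<pi>\<close>, which gives the closed form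
(\<open>tendsto_crossing_probability\<close>).
\<close>

section \<open>Rotations preserve product Lebesgue measure\<close>

abbreviation lborel_Pi :: "'i set \<Rightarrow> ('i \<Rightarrow> real) measure" where
  "lborel_Pi I \<equiv> \<Pi>\<^sub>M k\<in>I. lborel"

lemma product_sigma_finite_lborel: "product_sigma_finite (\<lambda>_. lborel :: real measure)"
  by standard

lemma nn_integral_lborel_Pi_remove:
  assumes "finite I" "i \<in> I" and F: "F \<in> borel_measurable (lborel_Pi I)"
  shows "(\<integral>\<^sup>+ x. F x \<partial>lborel_Pi I) = (\<integral>\<^sup>+ x. \<integral>\<^sup>+ s. F (x(i := s)) \<partial>lborel \<partial>lborel_Pi (I - {i}))"
  using product_sigma_finite.product_nn_integral_insert[OF product_sigma_finite_lborel, of "I - {i}" i F] assms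
  by (simp add: insert_absorb)

lemma measurable_lborel_Pi_update:
  assumes "i \<in> I" "g \<in> M \<rightarrow>\<^sub>M lborel_Pi (I - {i})" "h \<in> borel_measurable M"
  shows "(\<lambda>x. (g x)(i := h x)) \<in> M \<rightarrow>\<^sub>M lborel_Pi I"
  using assms by (intro measurable_fun_upd[where J="I - {i}"]) auto

lemma measurable_lborel_Pi_update':
  assumes "i \<in> I" "g \<in> M \<rightarrow>\<^sub>M lborel_Pi I" "h \<in> borel_measurable M"
  shows "(\<lambda>x. (g x)(i := h x)) \<in> M \<rightarrow>\<^sub>M lborel_Pi I"
  using assms by (intro measurable_fun_upd[where J="I"]) auto

definition shear :: "'i \<Rightarrow> 'i \<Rightarrow> real \<Rightarrow> ('i \<Rightarrow> real) \<Rightarrow> 'i \<Rightarrow> real" where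
  "shear i j t x = x(i := x i + t * x j)"

lemma measurable_shear:
  assumes "i \<in> I" "j \<in> I"
  shows "shear i j t \<in> lborel_Pi I \<rightarrow>\<^sub>M lborel_Pi I"
  unfolding shear_def[abs_def]
  using assms by (intro measurable_lborel_Pi_update') auto

text \<open>By Tonelli's theorem the coordinate \<open>i\<close> may be integrated first; the other coordinates are then
constant, and a shear is a translation of the line.\<close>

lemma nn_integral_shear:
  assumes "finite I" "i \<in> I" "j \<in> I" "i \<noteq> j" and F: "F \<in> borel_measurable (lborel_Pi I)"
  shows "(\<integral>\<^sup>+ x. F (shear i j t x) \<partial>lborel_Pi I) = (\<integral>\<^sup>+ x. F x \<partial>lborel_Pi I)"
proof -
  have "(\<integral>\<^sup>+ x. F (shear i j t x) \<partial>lborel_Pi I)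
      = (\<integral>\<^sup>+ x. \<integral>\<^sup>+ s. F (x(i := t * x j + 1 * s)) \<partial>lborel \<partial>lborel_Pi (I - {i}))"
    using assms measurable_compose[OF measurable_shear F, of i j t]
    by (subst nn_integral_lborel_Pi_remove[where i=i]) (auto simp: shear_def add.commute)
  also have "\<dots> = (\<integral>\<^sup>+ x. \<integral>\<^sup>+ s. F (x(i := s)) \<partial>lborel \<partial>lborel_Pi (I - {i}))"
  proof (rule nn_integral_cong)
    fix x assume x: "x \<in> space (lborel_Pi (I - {i}))"
    have "(\<lambda>s. x(i := s)) \<in> borel \<rightarrow>\<^sub>M lborel_Pi I"
      using assms x by (intro measurable_lborel_Pi_update) auto
    then show "(\<integral>\<^sup>+ s. F (x(i := t * x j + 1 * s)) \<partial>lborel) = (\<integral>\<^sup>+ s. F (x(i := s)) \<partial>lborel)"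
      using F by (subst nn_integral_real_affine[where c=1 and t="t * x j" and f="\<lambda>s. F (x(i := s))"]) auto
  qed
  also have "\<dots> = (\<integral>\<^sup>+ x. F x \<partial>lborel_Pi I)"
    using assms by (intro nn_integral_lborel_Pi_remove[symmetric]) auto
  finally show ?thesis .
qed

definition plane_rotation :: "'i \<Rightarrow> 'i \<Rightarrow> real \<Rightarrow> real \<Rightarrow> ('i \<Rightarrow> real) \<Rightarrow> 'i \<Rightarrow> real" where
  "plane_rotation i j c s x = x(i := c * x i - s * x j, j := s * x i + c * x j)"

lemma measurable_plane_rotation:
  assumes "i \<in> I" "j \<in> I"
  shows "plane_rotation i j c s \<in> lborel_Pi I \<rightarrow>\<^sub>M lborel_Pi I"
  unfolding plane_rotation_def[abs_def]
  using assms by (intro measurable_lborel_Pi_update') auto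

text \<open>This factorisation makes rotation invariance of a product measure a consequence of translation
invariance on the line, without determinants. With \<open>c = cos \<phi>\<close> and \<open>s = sin \<phi>\<close>, the outer shear
parameter is \<open>(c - 1) / s = - tan (\<phi> / 2)\<close>, which is infinite for the half turn.\<close>

lemma plane_rotation_eq_shears:
  assumes "i \<noteq> j" "c\<^sup>2 + s\<^sup>2 = 1" "s \<noteq> 0"
  shows "plane_rotation i j c s x = shear i j ((c - 1) / s) (shear j i s (shear i j ((c - 1) / s) x))"
proof -
  define t where "t = (c - 1) / s"
  have ts: "t * s = c - 1" using assms by (simp add: t_def)
  have "t * (1 + c) * s = (c - 1) * (1 + c)"
    using ts by algebra
  also have "\<dots> = - s * s"
    using assms(2) by algebra
  finally have "t * (1 + c) * s = - s * s" .
  then have "(t * (1 + c) + s) * s = 0" by (simp add: algebra_simps)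
  then have tc: "t * (1 + c) = - s" using assms(3) by simp
  have j: "s * (x i + t * x j) + x j = s * x i + c * x j" using ts by algebra
  have i: "x i + t * x j + t * (s * x i + c * x j) = c * x i - s * x j" using ts tc by algebra
  show ?thesis unfolding plane_rotation_def shear_def t_def[symmetric] using assms(1) i j
    by (auto simp: fun_eq_iff add.commute)
qed

lemma nn_integral_plane_rotation:
  assumes "finite I" "i \<in> I" "j \<in> I" "i \<noteq> j" "c\<^sup>2 + s\<^sup>2 = 1" "s \<noteq> 0"
    and F: "F \<in> borel_measurable (lborel_Pi I)"
  shows "(\<integral>\<^sup>+ x. F (plane_rotation i j c s x) \<partial>lborel_Pi I) = (\<integral>\<^sup>+ x. F x \<partial>lborel_Pi I)"
proof -
  let ?t = "(c - 1) / s"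
  note m = measurable_shear[OF assms(2,3)] measurable_shear[OF assms(3,2)]
  note F1 = measurable_compose[OF m(1) F, of ?t]
  note F2 = measurable_compose[OF m(2) F1, of s]
  have "(\<integral>\<^sup>+ x. F (plane_rotation i j c s x) \<partial>lborel_Pi I)
     = (\<integral>\<^sup>+ x. F (shear i j ?t (shear j i s (shear i j ?t x))) \<partial>lborel_Pi I)"
    using assms by (simp add: plane_rotation_eq_shears)
  also have "\<dots> = (\<integral>\<^sup>+ x. F (shear i j ?t (shear j i s x)) \<partial>lborel_Pi I)"
    using assms F2 by (intro nn_integral_shear) auto
  also have "\<dots> = (\<integral>\<^sup>+ x. F (shear i j ?t x) \<partial>lborel_Pi I)"
    using assms F1 by (intro nn_integral_shear) auto
  also have "\<dots> = (\<integral>\<^sup>+ x. F x \<partial>lborel_Pi I)"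
    using assms by (intro nn_integral_shear) auto
  finally show ?thesis .
qed

definition dot :: "'i set \<Rightarrow> ('i \<Rightarrow> real) \<Rightarrow> ('i \<Rightarrow> real) \<Rightarrow> real" where
  "dot I u x = (\<Sum>k\<in>I. u k * x k)"

lemma dot_commute: "dot I u x = dot I x u"
  by (simp add: dot_def mult.commute)

lemma measurable_dot [measurable]: "dot I u \<in> borel_measurable (lborel_Pi I)"
  unfolding dot_def[abs_def] by measurable

lemma dot_split2:
  assumes "finite I" "i \<in> I" "j \<in> I" "i \<noteq> j"
  shows "dot I u x = u i * x i + u j * x j + dot (I - {i, j}) u x"
proof -
  have "I = insert i (insert j (I - {i,j}))" using assms by auto
  then show ?thesis
    unfolding dot_def using assms(1,4)
    by (metis (no_types, lifting) Diff_iff add.assoc finite_Diff finite_insert insertCI insertE sum.insert)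
qed

lemma dot_plane_rotation:
  assumes "finite I" "i \<in> I" "j \<in> I" "i \<noteq> j"
  shows "dot I u (plane_rotation i j c s x) = dot I (plane_rotation i j c (-s) u) x"
proof -
  have "dot (I - {i,j}) u (plane_rotation i j c s x) = dot (I - {i,j}) (plane_rotation i j c (-s) u) x"
    unfolding dot_def by (intro sum.cong) (auto simp: plane_rotation_def)
  then show ?thesis
    unfolding dot_split2[OF assms] using assms(4) by (simp add: plane_rotation_def algebra_simps)
qed

lemma dot_plane_rotation_both:
  assumes "finite I" "i \<in> I" "j \<in> I" "i \<noteq> j" "c\<^sup>2 + s\<^sup>2 = 1"
  shows "dot I (plane_rotation i j c s u) (plane_rotation i j c s x) = dot I u x"
proof -
  have "dot (I - {i,j}) (plane_rotation i j c s u) (plane_rotation i j c s x) = dot (I - {i,j}) u x"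
    unfolding dot_def by (intro sum.cong) (auto simp: plane_rotation_def)
  moreover have "(c * u i - s * u j) * (c * x i - s * x j) + (s * u i + c * u j) * (s * x i + c * x j)
     = u i * x i + u j * x j" using assms(5) by algebra
  ultimately show ?thesis
    unfolding dot_split2[OF assms(1-4)] using assms(4) by (simp add: plane_rotation_def)
qed

text \<open>An orthogonal map \<open>T\<close> that acts only on the coordinates in \<open>J\<close>, together with its transpose
\<open>T'\<close>, which moves linear forms instead of points. That \<open>T\<close> preserves Lebesgue measure is part of
the definition, since it is inherited from the plane rotations of which \<open>T\<close> is composed.\<close>

definition rotation_within :: "'i set \<Rightarrow> 'i set \<Rightarrow> (('i \<Rightarrow> real) \<Rightarrow> 'i \<Rightarrow> real) \<Rightarrow>
    (('i \<Rightarrow> real) \<Rightarrow> 'i \<Rightarrow> real) \<Rightarrow> bool" where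
  "rotation_within J I T T' \<longleftrightarrow>
     T \<in> lborel_Pi I \<rightarrow>\<^sub>M lborel_Pi I \<and>
     (\<forall>F\<in>borel_measurable (lborel_Pi I). (\<integral>\<^sup>+ x. F (T x) \<partial>lborel_Pi I) = (\<integral>\<^sup>+ x. F x \<partial>lborel_Pi I)) \<and>
     (\<forall>u x. dot I u (T x) = dot I (T' u) x) \<and>
     (\<forall>x. dot I (T x) (T x) = dot I x x) \<and>
     (\<forall>u v. dot I (T' u) (T' v) = dot I u v) \<and>
     (\<forall>x. \<forall>k\<in>I - J. T x k = x k) \<and> (\<forall>u. \<forall>k\<in>I - J. T' u k = u k)"

lemma rotation_within_id: "rotation_within J I (\<lambda>x. x) (\<lambda>x. x)"
  by (simp add: rotation_within_def)

lemma rotation_within_mono: "rotation_within J I T T' \<Longrightarrow> J \<subseteq> K \<Longrightarrow> rotation_within K I T T'"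
  unfolding rotation_within_def by blast

lemma nn_integral_rotation_within:
  assumes "rotation_within J I T T'" "F \<in> borel_measurable (lborel_Pi I)"
  shows "(\<integral>\<^sup>+ x. F (T x) \<partial>lborel_Pi I) = (\<integral>\<^sup>+ x. F x \<partial>lborel_Pi I)"
  using assms by (simp add: rotation_within_def)

lemma rotation_within_compose:
  assumes "rotation_within J I S S'" "rotation_within J I T T'"
  shows "rotation_within J I (\<lambda>x. S (T x)) (\<lambda>u. T' (S' u))"
proof -
  have "(\<integral>\<^sup>+ x. F (S (T x)) \<partial>lborel_Pi I) = (\<integral>\<^sup>+ x. F x \<partial>lborel_Pi I)"
    if F: "F \<in> borel_measurable (lborel_Pi I)" for F
  proof -
    have "(\<lambda>x. F (S x)) \<in> borel_measurable (lborel_Pi I)"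
      using assms(1) F by (auto simp: rotation_within_def)
    then have "(\<integral>\<^sup>+ x. F (S (T x)) \<partial>lborel_Pi I) = (\<integral>\<^sup>+ x. F (S x) \<partial>lborel_Pi I)"
      by (rule nn_integral_rotation_within[OF assms(2)])
    also have "\<dots> = (\<integral>\<^sup>+ x. F x \<partial>lborel_Pi I)"
      by (rule nn_integral_rotation_within[OF assms(1) F])
    finally show ?thesis .
  qed
  moreover have "(\<lambda>x. S (T x)) \<in> lborel_Pi I \<rightarrow>\<^sub>M lborel_Pi I"
    using assms unfolding rotation_within_def by (auto intro: measurable_compose)
  moreover have "dot I (S (T x)) (S (T x)) = dot I x x" for x
    using assms unfolding rotation_within_def by metis
  ultimately show ?thesis
    using assms unfolding rotation_within_def by simp
qed

lemma rotation_within_plane_rotation: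
  assumes "finite I" "i \<in> J" "j \<in> J" "J \<subseteq> I" "i \<noteq> j" "c\<^sup>2 + s\<^sup>2 = 1" "s \<noteq> 0"
  shows "rotation_within J I (plane_rotation i j c s) (plane_rotation i j c (-s))"
proof -
  have ij: "i \<in> I" "j \<in> I" using assms by auto
  show ?thesis
    unfolding rotation_within_def
    using assms ij measurable_plane_rotation[OF ij] nn_integral_plane_rotation[OF assms(1) ij assms(5-7)]
      dot_plane_rotation[OF assms(1) ij assms(5)] dot_plane_rotation_both[OF assms(1) ij assms(5), of c s]
      dot_plane_rotation_both[OF assms(1) ij assms(5), of c "-s"]
    by (auto simp: plane_rotation_def)
qed

text \<open>Plane rotations in the planes \<open>(i, j)\<close> with \<open>j \<in> J\<close> remove the coefficients of the linear form
\<open>u\<close> one at a time, moving their weight to the coordinate \<open>i\<close>.\<close>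

lemma ex_rotation_within_to_axis:
  assumes "finite I" "J \<subseteq> I" "i \<in> J"
  shows "\<exists>T T'. rotation_within J I T T' \<and> (\<forall>k\<in>J - {i}. T' u k = 0)"
proof -
  have "finite K \<Longrightarrow> K \<subseteq> J - {i} \<Longrightarrow>
     \<exists>T T'. rotation_within (insert i K) I T T' \<and> (\<forall>k\<in>K. T' u k = 0)" for K
  proof (induction K rule: finite_induct)
    case empty
    then show ?case using rotation_within_id by blast
  next
    case (insert j K)
    then obtain S S' where S: "rotation_within (insert i K) I S S'" "\<forall>k\<in>K. S' u k = 0" by blast
    have S1: "rotation_within (insert i (insert j K)) I S S'"
      by (rule rotation_within_mono[OF S(1)]) auto
    show ?case
    proof (cases "S' u j = 0")
      case True
      then show ?thesis using S S1 by blast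
    next
      case False
      let ?a = "S' u i" and ?b = "S' u j"
      define r where "r = sqrt (?a\<^sup>2 + ?b\<^sup>2)"
      have r: "r > 0" "r * r = ?a\<^sup>2 + ?b\<^sup>2" using False by (auto simp: r_def sum_power2_gt_zero_iff)
      have cs: "(?a / r)\<^sup>2 + (?b / r)\<^sup>2 = 1"
      proof -
        have "(?a / r)\<^sup>2 + (?b / r)\<^sup>2 = (?a\<^sup>2 + ?b\<^sup>2) / (r * r)"
          by (simp add: power_divide add_divide_distrib power2_eq_square)
        then show ?thesis using r(1) by (simp add: r(2)[symmetric])
      qed
      let ?T = "plane_rotation i j (?a / r) (?b / r)" and ?T' = "plane_rotation i j (?a / r) (- (?b / r))"
      have "rotation_within (insert i (insert j K)) I ?T ?T'"
        using assms insert cs r(1) False by (intro rotation_within_plane_rotation) auto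
      from rotation_within_compose[OF S1 this]
      have "rotation_within (insert i (insert j K)) I (\<lambda>x. S (?T x)) (\<lambda>v. ?T' (S' v))" .
      moreover have "\<forall>k\<in>insert j K. ?T' (S' u) k = 0"
        using S insert r by (auto simp: plane_rotation_def algebra_simps)
      ultimately show ?thesis by (intro exI[of _ "\<lambda>x. S (?T x)"] exI[of _ "\<lambda>v. ?T' (S' v)"]) simp
    qed
  qed
  from this[of "J - {i}"] show ?thesis
    using assms by (simp add: insert_absorb finite_subset)
qed

section \<open>The volume of a sector of the ball\<close>

lemma nn_integral_lborel_Pi_remove2:
  assumes "finite I" "i \<in> I" "j \<in> I" "i \<noteq> j" and F: "F \<in> borel_measurable (lborel_Pi I)"
  shows "(\<integral>\<^sup>+ x. F x \<partial>lborel_Pi I)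
    = (\<integral>\<^sup>+ x. \<integral>\<^sup>+ t. \<integral>\<^sup>+ s. F (x(j := t, i := s)) \<partial>lborel \<partial>lborel \<partial>lborel_Pi (I - {i, j}))"
proof -
  have m: "(\<lambda>p. F ((fst p)(i := snd p))) \<in> borel_measurable (lborel_Pi (I - {i}) \<Otimes>\<^sub>M lborel)"
    using assms by (intro measurable_compose[OF measurable_lborel_Pi_update F]) auto
  have "(\<integral>\<^sup>+ x. F x \<partial>lborel_Pi I) = (\<integral>\<^sup>+ x. \<integral>\<^sup>+ s. F (x(i := s)) \<partial>lborel \<partial>lborel_Pi (I - {i}))"
    using assms by (intro nn_integral_lborel_Pi_remove)
  also have "\<dots> = (\<integral>\<^sup>+ x. \<integral>\<^sup>+ t. \<integral>\<^sup>+ s. F (x(j := t, i := s)) \<partial>lborel \<partial>lborel \<partial>lborel_Pi (I - {i} - {j}))"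
    using assms m by (intro nn_integral_lborel_Pi_remove lborel.borel_measurable_nn_integral)
      (auto simp: case_prod_beta)
  also have "I - {i} - {j} = I - {i, j}" by auto
  finally show ?thesis .
qed

lemma nn_integral_inverse_1_plus_square:
  assumes "0 \<le> \<tau>"
  shows "(\<integral>\<^sup>+ u. indicator {u. \<bar>u\<bar> < \<tau>} u * ennreal (1 / (1 + u\<^sup>2)) \<partial>lborel) = ennreal (2 * arctan \<tau>)"
proof -
  have "(\<integral>\<^sup>+ u. indicator {u. \<bar>u\<bar> < \<tau>} u * ennreal (1 / (1 + u\<^sup>2)) \<partial>lborel)
      = (\<integral>\<^sup>+ u. ennreal (1 / (1 + u\<^sup>2)) * indicator {-\<tau>..\<tau>} u \<partial>lborel)"
    by (intro nn_integral_cong_AE AE_I[of _ _ "{-\<tau>, \<tau>}"])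
       (auto simp: indicator_def emeasure_lborel_countable split: if_splits)
  also have "\<dots> = ennreal (arctan \<tau> - arctan (-\<tau>))"
    using assms
    by (intro nn_integral_FTC_Icc) (auto intro!: derivative_eq_intros simp: add_pos_nonneg inverse_eq_divide)
  finally show ?thesis by (simp add: arctan_minus)
qed

text \<open>The substitution \<open>s = t u\<close> turns the sector into the strip \<open>\<bar>u\<bar> < \<tau>\<close>. After exchanging the
integrals, the substitution \<open>t = w / sqrt (1 + u\<^sup>2)\<close> separates the variables: the slope
\<open>u\<close> has the Cauchy density up to a factor that depends on \<open>R\<close> only. This factor is the same for
all \<open>\<tau>\<close> and cancels in the quotient of two sectors, so it is left as an integral.\<close>

lemma nn_integral_disc_sector:
  assumes "0 \<le> \<tau>"
  shows "(\<integral>\<^sup>+ t. \<integral>\<^sup>+ s. indicator {(s, t). \<bar>s\<bar> < \<tau> * \<bar>t\<bar> \<and> s\<^sup>2 + t\<^sup>2 \<le> R} (s, t) \<partial>lborel \<partial>lborel)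
    = ennreal (2 * arctan \<tau>) * (\<integral>\<^sup>+ w. ennreal \<bar>w\<bar> * indicator {w. w\<^sup>2 \<le> R} w \<partial>lborel)" (is "?L = _ * ?A")
proof -
  let ?S = "{(s::real, t::real). \<bar>s\<bar> < \<tau> * \<bar>t\<bar> \<and> s\<^sup>2 + t\<^sup>2 \<le> R}"
  have [measurable]: "?S \<in> sets (borel \<Otimes>\<^sub>M borel)"
  proof -
    have "{p \<in> space (borel \<Otimes>\<^sub>M borel). \<bar>fst p\<bar> < \<tau> * \<bar>snd p\<bar> \<and> (fst p)\<^sup>2 + (snd p)\<^sup>2 \<le> R} \<in> sets (borel \<Otimes>\<^sub>M borel)"
      by measurable
    also have "{p \<in> space (borel \<Otimes>\<^sub>M borel). \<bar>fst p\<bar> < \<tau> * \<bar>snd p\<bar> \<and> (fst p)\<^sup>2 + (snd p)\<^sup>2 \<le> R} = ?S"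
      by (auto simp: space_pair_measure)
    finally show ?thesis .
  qed
  have "?L = (\<integral>\<^sup>+ t. \<integral>\<^sup>+ u. ennreal \<bar>t\<bar> * indicator {u. \<bar>u\<bar> < \<tau>} u * indicator {t. t\<^sup>2 * (1 + u\<^sup>2) \<le> R} t \<partial>lborel \<partial>lborel)"
  \<comment> \<open>For \<open>t = 0\<close> the substitution is degenerate; this single point is null.\<close>
  proof (intro nn_integral_cong_AE AE_I[of _ _ "{0}"] subsetI CollectI)
    fix t assume "t \<in> {t \<in> space lborel. (\<integral>\<^sup>+ s. indicator ?S (s, t) \<partial>lborel) \<noteq>
       (\<integral>\<^sup>+ u. ennreal \<bar>t\<bar> * indicator {u. \<bar>u\<bar> < \<tau>} u * indicator {t. t\<^sup>2 * (1 + u\<^sup>2) \<le> R} t \<partial>lborel)}"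
    moreover have "(\<integral>\<^sup>+ s. indicator ?S (s, t) \<partial>lborel) =
       (\<integral>\<^sup>+ u. ennreal \<bar>t\<bar> * indicator {u. \<bar>u\<bar> < \<tau>} u * indicator {t. t\<^sup>2 * (1 + u\<^sup>2) \<le> R} t \<partial>lborel)"
      if t: "t \<noteq> 0"
    proof -
      have "(\<integral>\<^sup>+ s. indicator ?S (s, t) \<partial>lborel) = ennreal \<bar>t\<bar> * (\<integral>\<^sup>+ u. indicator ?S (0 + t * u, t) \<partial>lborel)"
        using t by (intro nn_integral_real_affine) auto
      also have "\<dots> = (\<integral>\<^sup>+ u. ennreal \<bar>t\<bar> * indicator ?S (0 + t * u, t) \<partial>lborel)"
        by (intro nn_integral_cmult[symmetric]) auto
      also have "\<dots> = (\<integral>\<^sup>+ u. ennreal \<bar>t\<bar> * indicator {u. \<bar>u\<bar> < \<tau>} u * indicator {t. t\<^sup>2 * (1 + u\<^sup>2) \<le> R} t \<partial>lborel)"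
      proof (rule nn_integral_cong)
        fix u
        have "\<bar>0 + t * u\<bar> < \<tau> * \<bar>t\<bar> \<longleftrightarrow> \<bar>u\<bar> < \<tau>"
          using t mult_less_cancel_right_pos[of "\<bar>t\<bar>" "\<bar>u\<bar>" \<tau>] by (simp add: abs_mult mult.commute)
        moreover have "(0 + t * u)\<^sup>2 + t\<^sup>2 = t\<^sup>2 * (1 + u\<^sup>2)" by algebra
        ultimately show "ennreal \<bar>t\<bar> * indicator ?S (0 + t * u, t) =
            ennreal \<bar>t\<bar> * indicator {u. \<bar>u\<bar> < \<tau>} u * indicator {t. t\<^sup>2 * (1 + u\<^sup>2) \<le> R} t"
          by (simp add: indicator_def)
      qed
      finally show ?thesis .
    qed
    ultimately show "t \<in> {0}" by auto
  qed auto
  also have "\<dots> = (\<integral>\<^sup>+ u. \<integral>\<^sup>+ t. ennreal \<bar>t\<bar> * indicator {u. \<bar>u\<bar> < \<tau>} u * indicator {t. t\<^sup>2 * (1 + u\<^sup>2) \<le> R} t \<partial>lborel \<partial>lborel)"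
    by (intro lborel_pair.Fubini') (simp add: indicator_def; measurable)
  also have "\<dots> = (\<integral>\<^sup>+ u. indicator {u. \<bar>u\<bar> < \<tau>} u * ennreal (1 / (1 + u\<^sup>2)) * ?A \<partial>lborel)"
  proof (rule nn_integral_cong)
    fix u :: real
    define r where "r = sqrt (1 + u\<^sup>2)"
    have r: "r > 0" "r\<^sup>2 = 1 + u\<^sup>2" by (auto simp: r_def add_pos_nonneg)
    have "(\<integral>\<^sup>+ t. ennreal \<bar>t\<bar> * indicator {t. t\<^sup>2 * (1 + u\<^sup>2) \<le> R} t \<partial>lborel)
        = ennreal \<bar>1 / r\<bar> * (\<integral>\<^sup>+ w. ennreal \<bar>0 + 1 / r * w\<bar> * indicator {t. t\<^sup>2 * (1 + u\<^sup>2) \<le> R} (0 + 1 / r * w) \<partial>lborel)"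
      using r by (intro nn_integral_real_affine) auto
    also have "\<dots> = ennreal (1 / r) * (\<integral>\<^sup>+ w. ennreal (1 / r) * (ennreal \<bar>w\<bar> * indicator {w. w\<^sup>2 \<le> R} w) \<partial>lborel)"
    proof -
      have "ennreal \<bar>0 + 1 / r * w\<bar> * indicator {t. t\<^sup>2 * (1 + u\<^sup>2) \<le> R} (0 + 1 / r * w)
         = ennreal (1 / r) * (ennreal \<bar>w\<bar> * indicator {w. w\<^sup>2 \<le> R} w)" for w
        using r by (auto simp: indicator_def abs_mult power_mult_distrib power_divide ennreal_mult'[symmetric]
            r(2)[symmetric])
      then show ?thesis using r by simp
    qed
    also have "\<dots> = ennreal (1 / r) * ennreal (1 / r) * ?A"
      by (subst nn_integral_cmult) (auto simp: mult.assoc)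
    also have "ennreal (1 / r) * ennreal (1 / r) = ennreal (1 / (1 + u\<^sup>2))"
      using r by (simp add: ennreal_mult'[symmetric] r(2)[symmetric] power2_eq_square)
    finally have e: "(\<integral>\<^sup>+ t. ennreal \<bar>t\<bar> * indicator {t. t\<^sup>2 * (1 + u\<^sup>2) \<le> R} t \<partial>lborel) = ennreal (1 / (1 + u\<^sup>2)) * ?A" .
    have "(\<integral>\<^sup>+ t. ennreal \<bar>t\<bar> * indicator {u. \<bar>u\<bar> < \<tau>} u * indicator {t. t\<^sup>2 * (1 + u\<^sup>2) \<le> R} t \<partial>lborel)
       = (\<integral>\<^sup>+ t. indicator {u. \<bar>u\<bar> < \<tau>} u * (ennreal \<bar>t\<bar> * indicator {t. t\<^sup>2 * (1 + u\<^sup>2) \<le> R} t) \<partial>lborel)"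
      by (simp only: mult_ac)
    also have "\<dots> = indicator {u. \<bar>u\<bar> < \<tau>} u * (ennreal (1 / (1 + u\<^sup>2)) * ?A)"
      by (subst nn_integral_cmult) (auto simp: e)
    finally show "(\<integral>\<^sup>+ t. ennreal \<bar>t\<bar> * indicator {u. \<bar>u\<bar> < \<tau>} u * indicator {t. t\<^sup>2 * (1 + u\<^sup>2) \<le> R} t \<partial>lborel)
       = indicator {u. \<bar>u\<bar> < \<tau>} u * ennreal (1 / (1 + u\<^sup>2)) * ?A" by (simp only: mult.assoc)
  qed
  also have "\<dots> = ennreal (2 * arctan \<tau>) * ?A"
    by (subst nn_integral_multc) (auto simp: nn_integral_inverse_1_plus_square[OF assms])
  finally show ?thesis .
qed

text \<open>The origin is omitted so that the ball consists exactly of the points that have a direction.\<close>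

definition punctured_ball :: "'i set \<Rightarrow> ('i \<Rightarrow> real) set" where
  "punctured_ball I = {x \<in> space (lborel_Pi I). 0 < dot I x x \<and> dot I x x \<le> 1}"

lemma measurable_dot_self [measurable]: "(\<lambda>x. dot I x x) \<in> borel_measurable (lborel_Pi I)"
  unfolding dot_def by measurable

lemma sets_punctured_ball [measurable]: "punctured_ball I \<in> sets (lborel_Pi I)"
  unfolding punctured_ball_def by measurable

lemma sets_punctured_ball_Collect:
  assumes "{x \<in> space (lborel_Pi I). P x} \<in> sets (lborel_Pi I)"
  shows "{x \<in> punctured_ball I. P x} \<in> sets (lborel_Pi I)"
proof -
  have "{x \<in> punctured_ball I. P x} = punctured_ball I \<inter> {x \<in> space (lborel_Pi I). P x}"
    by (auto simp: punctured_ball_def)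
  then show ?thesis using assms by auto
qed

lemma emeasure_punctured_ball_finite:
  assumes "finite I"
  shows "emeasure (lborel_Pi I) (punctured_ball I) < \<infinity>"
proof -
  have "punctured_ball I \<subseteq> (\<Pi>\<^sub>E k\<in>I. {-1..1})"
  proof (rule subsetI, rule PiE_I)
    fix x k assume x: "x \<in> punctured_ball I" and k: "k \<in> I"
    have "x k * x k \<le> dot I x x"
      unfolding dot_def using k assms by (intro member_le_sum) auto
    with x have "\<bar>x k\<bar> \<le> 1" by (simp add: punctured_ball_def abs_square_le_1[symmetric] power2_eq_square)
    then show "x k \<in> {-1..1}" by auto
  qed (auto simp: punctured_ball_def space_PiM PiE_def extensional_def)
  then have "emeasure (lborel_Pi I) (punctured_ball I) \<le> emeasure (lborel_Pi I) (\<Pi>\<^sub>E k\<in>I. {-1..1})"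
    using assms by (intro emeasure_mono sets_PiM_I_finite) auto
  also have "\<dots> = (\<Prod>k\<in>I. ennreal 2)"
    using assms by (subst product_sigma_finite.emeasure_PiM[OF product_sigma_finite_lborel]) auto
  also have "\<dots> < \<infinity>" by (simp add: power_less_top_ennreal)
  finally show ?thesis .
qed

lemma emeasure_punctured_ball_pos:
  assumes "finite I" "I \<noteq> {}"
  shows "emeasure (lborel_Pi I) (punctured_ball I) > 0"
proof -
  define d where "d = 1 / real (card I)"
  have c: "real (card I) \<ge> 1" using assms by (simp add: Suc_le_eq card_gt_0_iff)
  then have d: "0 < d" "d \<le> 1" "real (card I) * d = 1" by (auto simp: d_def)
  have "(\<Pi>\<^sub>E k\<in>I. {0<..d}) \<subseteq> punctured_ball I"
  proof
    fix x assume x: "x \<in> (\<Pi>\<^sub>E k\<in>I. {0<..d})"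
    then have b: "0 < x k" "x k \<le> d" if "k \<in> I" for k using that by auto
    have "x k * x k \<le> d" if "k \<in> I" for k
      using mult_mono[of "x k" d "x k" 1] b[OF that] d by auto
    then have "dot I x x \<le> (\<Sum>k\<in>I. d)" unfolding dot_def by (intro sum_mono)
    then have "dot I x x \<le> 1" using d by simp
    moreover have "0 < dot I x x" unfolding dot_def using assms b by (intro sum_pos) auto
    ultimately show "x \<in> punctured_ball I" using x by (auto simp: punctured_ball_def space_PiM PiE_def)
  qed
  then have "emeasure (lborel_Pi I) (\<Pi>\<^sub>E k\<in>I. {0<..d}) \<le> emeasure (lborel_Pi I) (punctured_ball I)"
    by (intro emeasure_mono) auto
  moreover have "emeasure (lborel_Pi I) (\<Pi>\<^sub>E k\<in>I. {0<..d}) = (\<Prod>k\<in>I. ennreal d)"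
    using assms d by (subst product_sigma_finite.emeasure_PiM[OF product_sigma_finite_lborel]) auto
  ultimately show ?thesis using d by (simp add: ennreal_power)
     (metis ennreal_0 ennreal_less_zero_iff not_gr_zero zero_less_power le_zero_eq)
qed

lemma AE_coordinate_nonzero:
  assumes "finite I" "j \<in> I"
  shows "AE x in lborel_Pi I. x j \<noteq> 0"
proof -
  have "(\<integral>\<^sup>+ x. indicator {0::real} (x j) \<partial>lborel_Pi I)
     = (\<integral>\<^sup>+ x. \<integral>\<^sup>+ s. indicator {0::real} ((x(j := s)) j) \<partial>lborel \<partial>lborel_Pi (I - {j}))"
    using assms by (intro nn_integral_lborel_Pi_remove) auto
  then have "(\<integral>\<^sup>+ x. indicator {0::real} (x j) \<partial>lborel_Pi I) = 0" by simp
  moreover have "(\<lambda>x. indicator {0::real} (x j) :: ennreal) \<in> borel_measurable (lborel_Pi I)"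
    using assms by measurable
  ultimately have "AE x in lborel_Pi I. indicator {0::real} (x j) = (0::ennreal)"
    by (simp only: nn_integral_0_iff_AE)
  then show ?thesis by eventually_elim (auto simp: indicator_def)
qed

text \<open>The constant \<open>K\<close> collects the contributions of the two-dimensional slices. It is finite because
the sector with \<open>\<tau> = 1\<close> has finite volume and \<open>arctan 1 > 0\<close>.\<close>

lemma emeasure_axis_sector:
  assumes "finite I" "i \<in> I" "j \<in> I" "i \<noteq> j"
  obtains K where "K < \<infinity>"
    "\<And>\<tau>. 0 \<le> \<tau> \<Longrightarrow> emeasure (lborel_Pi I) {x \<in> punctured_ball I. \<bar>x i\<bar> < \<tau> * \<bar>x j\<bar>} = ennreal (2 * arctan \<tau>) * K"
proof -
  define A where "A = (\<lambda>R::real. \<integral>\<^sup>+ w. ennreal \<bar>w\<bar> * indicator {w. w\<^sup>2 \<le> R} w \<partial>lborel)"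
  have [measurable]: "A \<in> borel_measurable borel"
    unfolding A_def by (intro lborel.borel_measurable_nn_integral) (simp add: indicator_def; measurable)
  let ?J = "I - {i, j}"
  define K where "K = (\<integral>\<^sup>+ x. A (1 - dot ?J x x) \<partial>lborel_Pi ?J)"
  let ?S = "\<lambda>\<tau>. {x \<in> punctured_ball I. \<bar>x i\<bar> < \<tau> * \<bar>x j\<bar>}"
  have S[measurable]: "?S \<tau> \<in> sets (lborel_Pi I)" for \<tau>
    using assms by (intro sets_punctured_ball_Collect) measurable
  have main: "emeasure (lborel_Pi I) (?S \<tau>) = ennreal (2 * arctan \<tau>) * K" if \<tau>: "0 \<le> \<tau>" for \<tau>
  proof -
    have "emeasure (lborel_Pi I) (?S \<tau>) = (\<integral>\<^sup>+ x. indicator (?S \<tau>) x \<partial>lborel_Pi I)"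
      by simp
    also have "\<dots> = (\<integral>\<^sup>+ x. \<integral>\<^sup>+ t. \<integral>\<^sup>+ s. indicator (?S \<tau>) (x(j := t, i := s)) \<partial>lborel \<partial>lborel \<partial>lborel_Pi ?J)"
      using assms by (intro nn_integral_lborel_Pi_remove2) auto
    also have "\<dots> = (\<integral>\<^sup>+ x. ennreal (2 * arctan \<tau>) * A (1 - dot ?J x x) \<partial>lborel_Pi ?J)"
    proof (rule nn_integral_cong)
      fix x assume x: "x \<in> space (lborel_Pi ?J)"
      have "indicator (?S \<tau>) (x(j := t, i := s))
         = (indicator {(s, t). \<bar>s\<bar> < \<tau> * \<bar>t\<bar> \<and> s\<^sup>2 + t\<^sup>2 \<le> 1 - dot ?J x x} (s, t) :: ennreal)" for s t
      proof -
        let ?y = "x(j := t, i := s)"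
        have "dot ?J ?y ?y = dot ?J x x" unfolding dot_def by (intro sum.cong) auto
        then have d: "dot I ?y ?y = s\<^sup>2 + t\<^sup>2 + dot ?J x x"
          unfolding dot_split2[OF assms] using assms(4) by (simp add: power2_eq_square)
        have y: "?y \<in> space (lborel_Pi I)"
          using x assms by (auto simp: space_PiM PiE_def extensional_def)
        have "0 < dot I ?y ?y" if "\<bar>s\<bar> < \<tau> * \<bar>t\<bar>"
        proof -
          have "t \<noteq> 0" using that by auto
          then have "0 < t\<^sup>2" by simp
          moreover have "0 \<le> dot ?J x x" unfolding dot_def by (intro sum_nonneg) auto
          ultimately show ?thesis unfolding d by (simp add: add_nonneg_pos add_pos_nonneg)
        qed
        then have "?y \<in> ?S \<tau> \<longleftrightarrow> \<bar>s\<bar> < \<tau> * \<bar>t\<bar> \<and> s\<^sup>2 + t\<^sup>2 \<le> 1 - dot ?J x x"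
          using y d assms(4) by (auto simp: punctured_ball_def)
        then show ?thesis by (simp add: indicator_def)
      qed
      then show "(\<integral>\<^sup>+ t. \<integral>\<^sup>+ s. indicator (?S \<tau>) (x(j := t, i := s)) \<partial>lborel \<partial>lborel) = ennreal (2 * arctan \<tau>) * A (1 - dot ?J x x)"
        unfolding A_def by (simp only: nn_integral_disc_sector[OF \<tau>])
    qed
    also have "\<dots> = ennreal (2 * arctan \<tau>) * K"
      unfolding K_def by (intro nn_integral_cmult) measurable
    finally show ?thesis .
  qed
  have "K < \<infinity>"
  proof -
    have "ennreal (2 * arctan 1) * K = emeasure (lborel_Pi I) (?S 1)" by (simp only: main zero_le_one)
    also have "\<dots> \<le> emeasure (lborel_Pi I) (punctured_ball I)"
      by (intro emeasure_mono sets_punctured_ball) auto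
    also have "\<dots> < \<infinity>" by (rule emeasure_punctured_ball_finite[OF assms(1)])
    finally have "ennreal (2 * arctan 1) * K < \<infinity>" .
    moreover have "ennreal (2 * arctan 1) \<noteq> 0" by (simp add: arctan_one)
    ultimately show ?thesis by (auto simp: ennreal_mult_less_top)
  qed
  then show ?thesis using main by (rule that)
qed

text \<open>As \<open>\<tau> \<rightarrow> \<infinity>\<close> the sectors exhaust the ball up to the hyperplane \<open>x j = 0\<close>, which identifies the
unknown constant as the volume of the ball divided by \<open>\<pi>\<close>.\<close>

lemma emeasure_axis_sector_eq:
  assumes "finite I" "i \<in> I" "j \<in> I" "i \<noteq> j" "0 \<le> \<tau>"
  shows "emeasure (lborel_Pi I) {x \<in> punctured_ball I. \<bar>x i\<bar> < \<tau> * \<bar>x j\<bar>}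
    = ennreal (2 / pi * arctan \<tau>) * emeasure (lborel_Pi I) (punctured_ball I)"
proof -
  obtain K where K: "K < \<infinity>"
    "\<And>\<tau>. 0 \<le> \<tau> \<Longrightarrow> emeasure (lborel_Pi I) {x \<in> punctured_ball I. \<bar>x i\<bar> < \<tau> * \<bar>x j\<bar>} = ennreal (2 * arctan \<tau>) * K"
    by (rule emeasure_axis_sector[OF assms(1-4)]) blast
  let ?S = "\<lambda>n. {x \<in> punctured_ball I. \<bar>x i\<bar> < real n * \<bar>x j\<bar>}"
  have S: "?S n \<in> sets (lborel_Pi I)" for n
    using assms by (intro sets_punctured_ball_Collect) measurable
  have "incseq ?S"
  proof (rule incseq_SucI, rule subsetI)
    fix n x assume x: "x \<in> ?S n"
    have "real n * \<bar>x j\<bar> \<le> real (Suc n) * \<bar>x j\<bar>" by (intro mult_right_mono) auto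
    with x show "x \<in> ?S (Suc n)" by (auto intro: less_le_trans)
  qed
  then have "(\<lambda>n. emeasure (lborel_Pi I) (?S n)) \<longlonglongrightarrow> emeasure (lborel_Pi I) (\<Union>n. ?S n)"
    using S by (intro Lim_emeasure_incseq) auto
  moreover have "emeasure (lborel_Pi I) (\<Union>n. ?S n) = emeasure (lborel_Pi I) (punctured_ball I)"
  proof (rule emeasure_eq_AE)
    show "AE x in lborel_Pi I. (x \<in> (\<Union>n. ?S n)) = (x \<in> punctured_ball I)"
      using AE_coordinate_nonzero[OF assms(1,3)]
    proof eventually_elim
      case (elim x)
      obtain n where "\<bar>x i\<bar> / \<bar>x j\<bar> < real n" using reals_Archimedean2 by blast
      then have "\<bar>x i\<bar> < real n * \<bar>x j\<bar>" using elim by (simp add: divide_less_eq)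
      then show ?case by auto
    qed
  qed (use S in auto)
  ultimately have "(\<lambda>n. ennreal (2 * arctan (real n)) * K) \<longlonglongrightarrow> emeasure (lborel_Pi I) (punctured_ball I)"
    using K(2) by simp
  moreover have "(\<lambda>n. ennreal (2 * arctan (real n)) * K) \<longlonglongrightarrow> ennreal (2 * (pi / 2)) * K"
    using K(1)
    by (intro tendsto_mult_ennreal tendsto_const tendsto_ennrealI tendsto_mult
        filterlim_compose[OF tendsto_arctan_at_top filterlim_real_sequentially]) auto
  ultimately have "emeasure (lborel_Pi I) (punctured_ball I) = ennreal (2 * (pi / 2)) * K"
    by (rule LIMSEQ_unique)
  then have "ennreal (2 / pi * arctan \<tau>) * emeasure (lborel_Pi I) (punctured_ball I)
     = ennreal (2 / pi * arctan \<tau> * pi) * K"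
    by (subst ennreal_mult''[OF pi_ge_zero]) (simp add: mult.assoc)
  then show ?thesis using K(2)[OF assms(5)] by simp
qed

text \<open>A first rotation makes \<open>p\<close> a multiple of the coordinate form \<open>i\<close>. Orthogonality is preserved, so
the image of \<open>q\<close> vanishes at \<open>i\<close>, and a second rotation that fixes the coordinate \<open>i\<close> makes it
a multiple of another coordinate form \<open>j\<close>. The multiples are the lengths of \<open>p\<close> and \<open>q\<close> up to sign.\<close>

lemma emeasure_sector:
  assumes "finite I" and orth: "dot I p q = 0" and p: "dot I p p > 0" and q: "dot I q q > 0"
  shows "emeasure (lborel_Pi I) {x \<in> punctured_ball I. \<bar>dot I p x\<bar> < \<bar>dot I q x\<bar>}
    = ennreal (2 / pi * arctan (sqrt (dot I q q / dot I p p))) * emeasure (lborel_Pi I) (punctured_ball I)"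
proof -
  have single: "dot I u x = u k * x k" if "k \<in> I" "\<forall>l\<in>I - {k}. u l = 0" for u x k
    unfolding dot_def using that assms(1) by (subst sum.remove[of I k]) auto
  obtain i where i: "i \<in> I" using p by (cases "I = {}") (auto simp: dot_def)
  obtain T T' where T: "rotation_within I I T T'" "\<forall>k\<in>I - {i}. T' p k = 0"
    using ex_rotation_within_to_axis[OF assms(1) subset_refl i] by blast
  define a where "a = T' p i"
  have pT: "dot I (T' p) x = a * x i" for x
    unfolding a_def using single[OF i T(2)] .
  have a: "a\<^sup>2 = dot I p p"
    using T(1) pT[of "T' p"] by (simp add: rotation_within_def power2_eq_square a_def)
  then have a0: "a \<noteq> 0" using p by auto
  have "a * T' q i = 0"
    using T(1) orth pT[of "T' q"] by (simp add: rotation_within_def)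
  then have qi: "T' q i = 0" using a0 by simp
  have "dot I (T' q) (T' q) > 0" using T(1) q by (simp add: rotation_within_def)
  then obtain j where j: "j \<in> I" "T' q j \<noteq> 0" 
    unfolding dot_def by (metis (no_types, lifting) less_irrefl mult_zero_left sum.neutral)
  then have ji: "j \<in> I - {i}" using qi by auto
  obtain S S' where S: "rotation_within (I - {i}) I S S'" "\<forall>k\<in>I - {i} - {j}. S' (T' q) k = 0"
    using ex_rotation_within_to_axis[OF assms(1) _ ji] by blast
  have Si: "S x i = x i" "S' u i = u i" for x u
    using S(1) i unfolding rotation_within_def by auto
  define b where "b = S' (T' q) j"
  have qS: "dot I (S' (T' q)) x = b * x j" for x
    unfolding b_def using S(2) qi Si(2) by (intro single[OF j(1)]) (metis Diff_iff singletonI singletonD)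
  have b: "b\<^sup>2 = dot I q q"
    using T(1) S(1) qS[of "S' (T' q)"] by (simp add: rotation_within_def power2_eq_square b_def)
  let ?E = "{x \<in> punctured_ball I. \<bar>dot I p x\<bar> < \<bar>dot I q x\<bar>}"
  have E: "?E \<in> sets (lborel_Pi I)"
    by (intro sets_punctured_ball_Collect) measurable
  have R: "rotation_within I I (\<lambda>x. T (S x)) (\<lambda>u. S' (T' u))"
    by (rule rotation_within_compose[OF T(1) rotation_within_mono[OF S(1)]]) auto
  have Rsp: "T (S x) \<in> space (lborel_Pi I)" if "x \<in> space (lborel_Pi I)" for x
    using R that unfolding rotation_within_def by (blast dest: measurable_space)
  have Rn: "dot I (T (S x)) (T (S x)) = dot I x x" for x
    using R unfolding rotation_within_def by blast
  have pR: "dot I p (T (S x)) = a * x i" for x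
    using T(1) pT[of "S x"] Si(1) by (simp add: rotation_within_def)
  have qR: "dot I q (T (S x)) = b * x j" for x
    using T(1) S(1) qS[of x] by (simp add: rotation_within_def)
  define \<tau> where "\<tau> = \<bar>b\<bar> / \<bar>a\<bar>"
  have \<tau>: "\<tau> = sqrt (dot I q q / dot I p p)"
    by (simp add: \<tau>_def real_sqrt_divide a[symmetric] b[symmetric])
  have "emeasure (lborel_Pi I) ?E = (\<integral>\<^sup>+ x. indicator ?E x \<partial>lborel_Pi I)" using E by simp
  also have "\<dots> = (\<integral>\<^sup>+ x. indicator ?E (T (S x)) \<partial>lborel_Pi I)"
    using E by (intro nn_integral_rotation_within[OF R, symmetric]) simp
  also have "\<dots> = (\<integral>\<^sup>+ x. indicator {x \<in> punctured_ball I. \<bar>x i\<bar> < \<tau> * \<bar>x j\<bar>} x \<partial>lborel_Pi I)"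
  proof (rule nn_integral_cong)
    fix x assume x: "x \<in> space (lborel_Pi I)"
    have "T (S x) \<in> ?E \<longleftrightarrow> x \<in> {x \<in> punctured_ball I. \<bar>x i\<bar> < \<tau> * \<bar>x j\<bar>}"
      using x Rsp[OF x] a0 by (simp add: punctured_ball_def Rn pR qR \<tau>_def abs_mult field_simps)
    then show "indicator ?E (T (S x)) = (indicator {x \<in> punctured_ball I. \<bar>x i\<bar> < \<tau> * \<bar>x j\<bar>} x :: ennreal)"
      by (simp only: indicator_def)
  qed
  also have "\<dots> = emeasure (lborel_Pi I) {x \<in> punctured_ball I. \<bar>x i\<bar> < \<tau> * \<bar>x j\<bar>}"
    using i j by (intro nn_integral_indicator sets_punctured_ball_Collect) measurable
  also have "\<dots> = ennreal (2 / pi * arctan \<tau>) * emeasure (lborel_Pi I) (punctured_ball I)"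
    using assms(1) i ji by (intro emeasure_axis_sector_eq) (auto simp: \<tau>_def)
  finally show ?thesis unfolding \<tau> .
qed

section \<open>Counting zeros by sign changes on dyadic grids\<close>

definition grid :: "nat \<Rightarrow> nat \<Rightarrow> real" where
  "grid k j = 2 * pi * real j / 2 ^ k"

definition sign_changes :: "(real \<Rightarrow> real) \<Rightarrow> nat \<Rightarrow> nat" where
  "sign_changes f k = card {j. j < 2 ^ k \<and> f (grid k j) * f (grid k (Suc j)) < 0}"

lemma grid_refine: "grid (Suc k) (2 * j) = grid k j"
  by (simp add: grid_def)

lemma grid_mono: "i \<le> j \<Longrightarrow> grid k i \<le> grid k j"
  by (simp add: grid_def divide_right_mono)

lemma grid_bounds: "0 \<le> grid k j" "j \<le> 2 ^ k \<Longrightarrow> grid k j \<le> 2 * pi"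
proof -
  show "0 \<le> grid k j" by (simp add: grid_def)
  assume "j \<le> 2 ^ k"
  then have "real j \<le> 2 ^ k" by (metis of_nat_le_iff of_nat_numeral of_nat_power)
  then show "grid k j \<le> 2 * pi" by (simp add: grid_def divide_le_eq)
qed

text \<open>Each interval with a sign change has a half with a sign change, because the value at the midpoint
is not zero.\<close>

lemma sign_changes_mono:
  assumes nz: "\<And>k j. f (grid k j) \<noteq> 0"
  shows "sign_changes f k \<le> sign_changes f (Suc k)"
proof -
  let ?S = "\<lambda>k. {j. j < 2 ^ k \<and> f (grid k j) * f (grid k (Suc j)) < 0}"
  define c where "c = (\<lambda>j. if f (grid (Suc k) (2*j)) * f (grid (Suc k) (2*j+1)) < 0 then 2*j else 2*j+1)"
  have "card (?S k) \<le> card (?S (Suc k))"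
  proof (rule card_inj_on_le[where f=c])
    have cj: "c j div 2 = j" for j by (simp add: c_def)
    show "inj_on c (?S k)" by (rule inj_on_inverseI[where g="\<lambda>n. n div 2"]) (rule cj)
    show "c ` ?S k \<subseteq> ?S (Suc k)"
    proof (intro image_subsetI CollectI)
      fix j assume "j \<in> ?S k"
      then have j: "j < 2 ^ k" "f (grid (Suc k) (2*j)) * f (grid (Suc k) (2*j+2)) < 0"
        using grid_refine[of k j] grid_refine[of k "Suc j"] by simp_all
      have "c j < 2 ^ Suc k" using j(1) by (simp add: c_def)
      moreover have "f (grid (Suc k) (c j)) * f (grid (Suc k) (Suc (c j))) < 0"
        using j(2) nz[of "Suc k" "2*j+1"]
        by (auto simp: c_def mult_less_0_iff not_less zero_le_mult_iff)
      ultimately show "c j < 2 ^ Suc k \<and> f (grid (Suc k) (c j)) * f (grid (Suc k) (Suc (c j))) < 0" ..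
    qed
  qed simp
  then show ?thesis unfolding sign_changes_def .
qed

lemma sign_changes_le_card_zeros:
  assumes cont: "continuous_on UNIV f"
  shows "of_nat (sign_changes f k) \<le> emeasure (count_space UNIV) {\<theta>\<in>{0..<2*pi}. f \<theta> = 0}"
proof (cases "finite {\<theta>\<in>{0..<2*pi}. f \<theta> = 0}")
  case True
  let ?S = "{j. j < 2 ^ k \<and> f (grid k j) * f (grid k (Suc j)) < 0}"
  have "\<forall>j\<in>?S. \<exists>z. grid k j < z \<and> z < grid k (Suc j) \<and> f z = 0"
  proof
    fix j assume j: "j \<in> ?S"
    have le: "grid k j \<le> grid k (Suc j)" by (rule grid_mono) simp
    have c: "continuous_on {grid k j..grid k (Suc j)} f"
      using cont by (rule continuous_on_subset) simp
    have "f (grid k j) * f (grid k (Suc j)) < 0" using j by simp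
    then have "f (grid k j) < 0 \<and> 0 < f (grid k (Suc j)) \<or> 0 < f (grid k j) \<and> f (grid k (Suc j)) < 0"
      by (auto simp: mult_less_0_iff)
    then have "\<exists>z\<ge>grid k j. z \<le> grid k (Suc j) \<and> f z = 0"
    proof
      assume "f (grid k j) < 0 \<and> 0 < f (grid k (Suc j))"
      then show ?thesis using IVT'[OF _ _ le c, of 0] by auto
    next
      assume "0 < f (grid k j) \<and> f (grid k (Suc j)) < 0"
      then show ?thesis using IVT2'[OF _ _ le c, of 0] by auto
    qed
    then obtain z where z: "grid k j \<le> z" "z \<le> grid k (Suc j)" "f z = 0" by blast
    moreover have "z \<noteq> grid k j" "z \<noteq> grid k (Suc j)" using j z(3) by auto
    ultimately show "\<exists>z. grid k j < z \<and> z < grid k (Suc j) \<and> f z = 0" by (intro exI[of _ z]) simp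
  qed
  from bchoice[OF this] obtain z
    where "\<forall>j\<in>?S. grid k j < z j \<and> z j < grid k (Suc j) \<and> f (z j) = 0" by (rule exE)
  then have z: "grid k j < z j \<and> z j < grid k (Suc j) \<and> f (z j) = 0" if "j \<in> ?S" for j
    using that by (rule bspec)
  have "inj_on z ?S"
  proof (rule linorder_inj_onI')
    fix i j assume ij: "i \<in> ?S" "j \<in> ?S" "i < j"
    then have "grid k (Suc i) \<le> grid k j" by (intro grid_mono) simp
    then show "z i \<noteq> z j" using z[OF ij(1)] z[OF ij(2)] by linarith
  qed
  moreover have "z ` ?S \<subseteq> {\<theta>\<in>{0..<2*pi}. f \<theta> = 0}"
  proof (rule image_subsetI)
    fix j assume j: "j \<in> ?S"
    then have "grid k (Suc j) \<le> 2 * pi" by (intro grid_bounds) simp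
    then show "z j \<in> {\<theta>\<in>{0..<2*pi}. f \<theta> = 0}"
      using z[OF j] grid_bounds(1)[of k j] by auto
  qed
  ultimately have "sign_changes f k \<le> card {\<theta>\<in>{0..<2*pi}. f \<theta> = 0}"
    unfolding sign_changes_def using True by (intro card_inj_on_le)
  then show ?thesis using True by (simp add: emeasure_count_space)
qed (simp add: emeasure_count_space)

lemma sign_change_at_simple_zero:
  fixes f :: "real \<Rightarrow> real"
  assumes "f z = 0" "(f has_real_derivative D) (at z)" "D \<noteq> 0"
  shows "\<exists>\<delta>>0. \<forall>x y. z - \<delta> < x \<longrightarrow> x < z \<longrightarrow> z < y \<longrightarrow> y < z + \<delta> \<longrightarrow> f x * f y < 0"
proof -
  have *: "\<exists>\<delta>>0. \<forall>x y. z - \<delta> < x \<longrightarrow> x < z \<longrightarrow> z < y \<longrightarrow> y < z + \<delta> \<longrightarrow> g x < 0 \<and> 0 < g y"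
    if g: "g z = 0" "(g has_real_derivative E) (at z)" "E > 0" for g :: "real \<Rightarrow> real" and E
  proof -
    obtain d where d: "d > 0" "\<And>h. 0 < h \<Longrightarrow> h < d \<Longrightarrow> g z < g (z + h)"
      using DERIV_pos_inc_right[OF g(2,3)] by blast
    obtain e where e: "e > 0" "\<And>h. 0 < h \<Longrightarrow> h < e \<Longrightarrow> g (z - h) < g z"
      using DERIV_pos_inc_left[OF g(2,3)] by blast
    show ?thesis
    proof (intro exI[of _ "min d e"] conjI allI impI)
      fix x y assume "z - min d e < x" "x < z" "z < y" "y < z + min d e"
      then show "g x < 0" "0 < g y" using d(2)[of "y - z"] e(2)[of "z - x"] g(1) by auto
    qed (use d e in auto)
  qed
  show ?thesis
  proof (cases "D > 0")
    case True
    with *[of f D] assms show ?thesis by (meson mult_neg_pos)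
  next
    case False
    then have "- D > 0" using assms by simp
    with *[of "\<lambda>x. - f x" "- D"] assms DERIV_minus[OF assms(2)]
    obtain \<delta> where "\<delta> > 0"
      "\<And>x y. z - \<delta> < x \<Longrightarrow> x < z \<Longrightarrow> z < y \<Longrightarrow> y < z + \<delta> \<Longrightarrow> f x > 0 \<and> f y < 0"
      by auto
    then show ?thesis by (metis mult_pos_neg)
  qed
qed

lemma card_simple_zeros_le_sign_changes:
  assumes nz: "\<And>k j. f (grid k j) \<noteq> 0"
    and simple: "\<And>\<theta>. \<theta> \<in> {0..<2*pi} \<Longrightarrow> f \<theta> = 0 \<Longrightarrow> \<exists>D. (f has_real_derivative D) (at \<theta>) \<and> D \<noteq> 0"
    and F: "finite F" "F \<subseteq> {\<theta>\<in>{0..<2*pi}. f \<theta> = 0}"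
  shows "\<exists>k. card F \<le> sign_changes f k"
proof -
  have "\<forall>z\<in>F. \<exists>\<delta>>0. \<forall>x y. z - \<delta> < x \<longrightarrow> x < z \<longrightarrow> z < y \<longrightarrow> y < z + \<delta> \<longrightarrow> f x * f y < 0"
    using simple F sign_change_at_simple_zero by blast
  then obtain d where d: "\<And>z. z \<in> F \<Longrightarrow> d z > 0"
    "\<And>z x y. z \<in> F \<Longrightarrow> z - d z < x \<Longrightarrow> x < z \<Longrightarrow> z < y \<Longrightarrow> y < z + d z \<Longrightarrow> f x * f y < 0"
    by metis
  \<comment> \<open>Within \<open>\<delta>\<close> of each point of \<open>F\<close> there is no further zero, and a grid with mesh below
    \<open>\<delta>\<close> therefore has the points of \<open>F\<close> in distinct intervals.\<close>
  define \<delta> where "\<delta> = Min (insert 1 (d ` F))"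
  have \<delta>: "\<delta> > 0" "\<And>z. z \<in> F \<Longrightarrow> \<delta> \<le> d z"
    using F(1) d(1) by (auto simp: \<delta>_def)
  obtain k where "(1/2) ^ k < \<delta> / (2 * pi)"
    using real_arch_pow_inv[of "\<delta> / (2 * pi)" "1/2"] \<delta>(1) by auto
  then have k: "2 * pi / 2 ^ k < \<delta>" by (simp add: field_simps power_one_over)
  have step: "grid k (Suc j) = grid k j + 2 * pi / 2 ^ k" for j
    by (simp add: grid_def field_simps)
  define c where "c = (\<lambda>z. nat \<lfloor>z * 2 ^ k / (2 * pi)\<rfloor>)"
  have c: "grid k (c z) < z \<and> z < grid k (Suc (c z)) \<and> c z < 2 ^ k" if z: "z \<in> F" for z
  proof -
    have z': "0 \<le> z" "z < 2 * pi" "f z = 0" using z F(2) by auto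
    have r: "real (c z) = of_int \<lfloor>z * 2 ^ k / (2 * pi)\<rfloor>"
      using z' by (simp add: c_def)
    have "real (c z) \<le> z * 2 ^ k / (2 * pi)" "z * 2 ^ k / (2 * pi) < real (c z) + 1"
      unfolding r by linarith+
    then have "grid k (c z) \<le> z" "z < grid k (Suc (c z))"
      by (simp_all add: grid_def field_simps)
    moreover have "grid k (c z) \<noteq> z" using nz z'(3) by metis
    moreover have "c z < 2 ^ k"
    proof -
      have "grid k (c z) < grid k (2 ^ k)"
        using \<open>grid k (c z) \<le> z\<close> z'(2) by (simp add: grid_def)
      then show ?thesis using grid_mono[of "2 ^ k" "c z" k] by (meson not_le)
    qed
    ultimately show ?thesis by simp
  qed
  have near: "z - d z < grid k (c z)" "grid k (Suc (c z)) < z + d z" if z: "z \<in> F" for z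
    using c[OF z] step[of "c z"] k \<delta>(2)[OF z] by linarith+
  have "card F \<le> card {j. j < 2 ^ k \<and> f (grid k j) * f (grid k (Suc j)) < 0}"
  proof (rule card_inj_on_le[where f=c])
    show "inj_on c F"
    proof (rule linorder_inj_onI')
      fix y z assume yz: "y \<in> F" "z \<in> F" "y < z"
      show "c y \<noteq> c z"
      proof
        assume "c y = c z"
        then have "z < y + d y" using near(2)[OF yz(1)] c[OF yz(2)] by simp
        then have "f (grid k (c y)) * f z < 0"
          using near(1)[OF yz(1)] c[OF yz(1)] yz by (intro d(2)[OF yz(1)]) auto
        then show False using yz(2) F(2) by auto
      qed
    qed
    show "c ` F \<subseteq> {j. j < 2 ^ k \<and> f (grid k j) * f (grid k (Suc j)) < 0}"
      using c near d(2) by auto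
  qed simp
  then show ?thesis unfolding sign_changes_def by blast
qed

text \<open>A grid interval with a sign change contains a zero, so no grid sees more sign changes than there are
zeros. Conversely, \<open>f\<close> changes its sign at a simple zero and has no other zero nearby, so a
sufficiently fine grid detects any given finite set of zeros. Finiteness of the set of zeros need not
be known beforehand.\<close>

lemma SUP_sign_changes:
  assumes cont: "continuous_on UNIV f"
    and nz: "\<And>k j. f (grid k j) \<noteq> 0"
    and simple: "\<And>\<theta>. \<theta> \<in> {0..<2*pi} \<Longrightarrow> f \<theta> = 0 \<Longrightarrow> \<exists>D. (f has_real_derivative D) (at \<theta>) \<and> D \<noteq> 0"
  shows "(SUP k. of_nat (sign_changes f k)) = emeasure (count_space UNIV) {\<theta>\<in>{0..<2*pi}. f \<theta> = 0}"
    (is "?L = emeasure _ ?Z")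
proof (rule antisym)
  show "?L \<le> emeasure (count_space UNIV) ?Z"
    using sign_changes_le_card_zeros[OF cont] by (intro SUP_least)
  have bound: "of_nat (card F) \<le> ?L" if F: "finite F" "F \<subseteq> ?Z" for F
  proof -
    obtain k where "card F \<le> sign_changes f k"
      using card_simple_zeros_le_sign_changes[OF nz simple F] by blast
    then show ?thesis by (intro SUP_upper2[of k]) auto
  qed
  show "emeasure (count_space UNIV) ?Z \<le> ?L"
  proof (cases "finite ?Z")
    case True
    then show ?thesis using bound[of ?Z] by (simp add: emeasure_count_space)
  next
    case False
    have "of_nat n \<le> ?L" for n
      using infinite_arbitrarily_large[OF False, of n] bound by metis
    then have "?L = \<infinity>"
      by (metis ennreal_Ex_less_of_nat infinity_ennreal_def leD top.not_eq_extremum)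
    then show ?thesis by (simp only: infinity_ennreal_def top_greatest)
  qed
qed

section \<open>Trigonometric polynomials and their derivatives\<close>

abbreviation modes :: "nat \<Rightarrow> int set" where
  "modes \<nu> \<equiv> {- int \<nu>..int \<nu>}"

definition trig_sum :: "nat \<Rightarrow> (int \<Rightarrow> real) \<Rightarrow> real \<Rightarrow> real" where
  "trig_sum \<nu> a \<theta> = (\<Sum>k\<in>modes \<nu>. a k * trig_basis k \<theta>)"

text \<open>Sines and cosines of the same frequency have opposite indices, so one formula covers all three kinds
of basis functions.\<close>

lemma trig_basis_has_derivative:
  "(trig_basis k has_real_derivative - of_int k * trig_basis (- k) \<theta>) (at \<theta>)"
proof -
  consider "k = 0" | "k > 0" | "k < 0" by linarith
  then show ?thesis
    by cases (auto simp: trig_basis_def[abs_def] intro!: derivative_eq_intros, simp_all add: field_simps)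
qed

lemma trig_sum_has_derivative:
  "(trig_sum \<nu> a has_real_derivative trig_sum \<nu> (\<lambda>k. of_int k * a (- k)) \<theta>) (at \<theta>)"
proof -
  have "((\<lambda>\<theta>. \<Sum>k\<in>modes \<nu>. a k * trig_basis k \<theta>) has_real_derivative
      (\<Sum>k\<in>modes \<nu>. a k * (- of_int k * trig_basis (- k) \<theta>))) (at \<theta>)"
    by (intro DERIV_sum DERIV_cmult trig_basis_has_derivative)
  also have "(\<Sum>k\<in>modes \<nu>. a k * (- of_int k * trig_basis (- k) \<theta>))
      = (\<Sum>k\<in>modes \<nu>. of_int k * a (- k) * trig_basis k \<theta>)"
    by (rule sum.reindex_bij_witness[of _ uminus uminus]) auto
  finally show ?thesis by (simp add: trig_sum_def[abs_def])
qed

lemma deriv_trig_sum: "deriv (trig_sum \<nu> a) = trig_sum \<nu> (\<lambda>k. of_int k * a (- k))"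
  by (intro ext DERIV_imp_deriv trig_sum_has_derivative)

lemma trig_space_eq_range: "trig_space \<nu> = range (trig_sum \<nu>)"
proof (rule antisym)
  have "fun_space.span (trig_basis ` modes \<nu>) \<subseteq> range (trig_sum \<nu>)"
  proof (rule fun_space.span_minimal)
    show "trig_basis ` modes \<nu> \<subseteq> range (trig_sum \<nu>)"
    proof (rule image_subsetI)
      fix k assume k: "k \<in> modes \<nu>"
      have "trig_basis k = trig_sum \<nu> (\<lambda>i. if i = k then 1 else 0)"
        using k by (auto simp: fun_eq_iff trig_sum_def if_distrib[of "\<lambda>x. x * _"] cong: if_cong)
      then show "trig_basis k \<in> range (trig_sum \<nu>)" by (metis rangeI)
    qed
    show "fun_space.subspace (range (trig_sum \<nu>))"
    proof (rule fun_space.subspaceI)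
      show "0 \<in> range (trig_sum \<nu>)"
        by (rule range_eqI[of _ _ "\<lambda>_. 0"]) (simp add: fun_eq_iff trig_sum_def)
    next
      fix u v assume "u \<in> range (trig_sum \<nu>)" "v \<in> range (trig_sum \<nu>)"
      then obtain a b where "u = trig_sum \<nu> a" "v = trig_sum \<nu> b" by blast
      then show "u + v \<in> range (trig_sum \<nu>)"
        by (intro range_eqI[of _ _ "\<lambda>k. a k + b k"]) (simp add: fun_eq_iff trig_sum_def sum.distrib distrib_right)
    next
      fix c u assume "u \<in> range (trig_sum \<nu>)"
      then obtain a where "u = trig_sum \<nu> a" by blast
      then show "(\<lambda>\<theta>. c * u \<theta>) \<in> range (trig_sum \<nu>)"
        by (intro range_eqI[of _ _ "\<lambda>k. c * a k"]) (simp add: fun_eq_iff trig_sum_def sum_distrib_left mult.assoc)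
    qed
  qed
  then show "trig_space \<nu> \<subseteq> range (trig_sum \<nu>)" by (simp add: span_trig_basis)
  show "range (trig_sum \<nu>) \<subseteq> trig_space \<nu>"
    using trig_synthesis_in_trig_space by (auto simp: trig_sum_def[abs_def])
qed

lemma trig_sum_in_trig_space: "trig_sum \<nu> a \<in> trig_space \<nu>"
  by (simp add: trig_space_eq_range)

lemma trig_space_deriv:
  assumes "v \<in> trig_space \<nu>"
  shows "deriv v \<in> trig_space \<nu>" "(v has_real_derivative deriv v \<theta>) (at \<theta>)"
  using assms trig_sum_has_derivative by (auto simp: trig_space_eq_range deriv_trig_sum)

lemma num_critical_points_eq:
  assumes "v \<in> trig_space \<nu>"
  shows "num_critical_points v = emeasure (count_space UNIV) {\<theta>\<in>{0..<2*pi}. deriv v \<theta> = 0}"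
proof -
  have "(v has_real_derivative 0) (at \<theta>) \<longleftrightarrow> deriv v \<theta> = 0" for \<theta>
    using trig_space_deriv(2)[OF assms, of \<theta>] DERIV_imp_deriv[of v 0 \<theta>] by auto
  then show ?thesis by (simp add: num_critical_points_def critical_points_def)
qed

section \<open>Almost every trigonometric polynomial is a Morse function\<close>

text \<open>The two exceptional events outside which the sign changes of \<open>v'\<close> on dyadic grids count the critical
points of \<open>v\<close>: a critical point on a grid, and a degenerate critical point.\<close>

definition grid_zero :: "(real \<Rightarrow> real) \<Rightarrow> bool" where
  "grid_zero v \<longleftrightarrow> (\<exists>k j. deriv v (grid k j) = 0)"

definition degenerate :: "(real \<Rightarrow> real) \<Rightarrow> bool" where
  "degenerate v \<longleftrightarrow> (\<exists>\<theta>\<in>{0..2*pi}. deriv v \<theta> = 0 \<and> deriv (deriv v) \<theta> = 0)"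

lemma num_critical_points_eq_SUP:
  assumes v: "v \<in> trig_space \<nu>" and "\<not> grid_zero v" "\<not> degenerate v"
  shows "num_critical_points v = (SUP k. of_nat (sign_changes (deriv v) k))"
proof -
  note v' = trig_space_deriv(1)[OF v]
  show ?thesis unfolding num_critical_points_eq[OF v]
  proof (rule SUP_sign_changes[symmetric])
    show "continuous_on UNIV (deriv v)" by (rule continuous_on_trig_space[OF v'])
    show "deriv v (grid k j) \<noteq> 0" for k j using assms(2) by (auto simp: grid_zero_def)
    show "\<exists>D. (deriv v has_real_derivative D) (at \<theta>) \<and> D \<noteq> 0"
      if "\<theta> \<in> {0..<2*pi}" "deriv v \<theta> = 0" for \<theta>
      using that assms(3) trig_space_deriv(2)[OF v', of \<theta>] by (force simp: degenerate_def)
  qed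
qed

text \<open>The \<open>\<sigma>\<close>-algebra is generated by evaluations, and derivatives are limits of difference quotients.\<close>

lemma measurable_deriv:
  assumes X: "X \<subseteq> trig_space \<nu>"
  shows "(\<lambda>v. deriv v \<theta>) \<in> borel_measurable (function_borel X)"
    and "(\<lambda>v. deriv (deriv v) \<theta>) \<in> borel_measurable (function_borel X)"
proof -
  have lim: "(\<lambda>n. (v (\<theta> + 1 / real (Suc n)) - v \<theta>) / (1 / real (Suc n))) \<longlonglongrightarrow> deriv v \<theta>"
    if "v \<in> trig_space \<nu>" for v \<theta>
  proof -
    have "((\<lambda>h. (v (\<theta> + h) - v \<theta>) / h) \<longlongrightarrow> deriv v \<theta>) (at 0)"
      using trig_space_deriv(2)[OF that, of \<theta>] by (simp add: DERIV_def)
    moreover have "filterlim (\<lambda>n. 1 / real (Suc n)) (at 0) sequentially"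
      unfolding filterlim_at using LIMSEQ_inverse_real_of_nat by (auto simp: inverse_eq_divide)
    ultimately show ?thesis by (rule filterlim_compose)
  qed
  have 1: "(\<lambda>v. deriv v \<theta>) \<in> borel_measurable (function_borel X)" for \<theta>
  proof (rule borel_measurable_LIMSEQ_real)
    show "(\<lambda>n. (v (\<theta> + 1 / real (Suc n)) - v \<theta>) / (1 / real (Suc n))) \<longlonglongrightarrow> deriv v \<theta>"
      if "v \<in> space (function_borel X)" for v
      using that X lim by auto
    show "(\<lambda>v. (v (\<theta> + 1 / real (Suc n)) - v \<theta>) / (1 / real (Suc n))) \<in> borel_measurable (function_borel X)" for n
      by (intro borel_measurable_divide borel_measurable_diff measurable_eval borel_measurable_const)
  qed
  show "(\<lambda>v. deriv v \<theta>) \<in> borel_measurable (function_borel X)" by (rule 1)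
  show "(\<lambda>v. deriv (deriv v) \<theta>) \<in> borel_measurable (function_borel X)"
  proof (rule borel_measurable_LIMSEQ_real)
    show "(\<lambda>n. (deriv v (\<theta> + 1 / real (Suc n)) - deriv v \<theta>) / (1 / real (Suc n))) \<longlonglongrightarrow> deriv (deriv v) \<theta>"
      if "v \<in> space (function_borel X)" for v
      using that X trig_space_deriv(1) by (intro lim) auto
    show "(\<lambda>v. (deriv v (\<theta> + 1 / real (Suc n)) - deriv v \<theta>) / (1 / real (Suc n))) \<in> borel_measurable (function_borel X)" for n
      by (intro borel_measurable_divide borel_measurable_diff 1 borel_measurable_const)
  qed
qed

text \<open>Compactness and density of the rationals replace an uncountable existential quantifier by countable
operations; this makes the set of degenerate functions measurable.\<close>

lemma ex_zero_Icc_iff_rational: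
  fixes g :: "real \<Rightarrow> real"
  assumes cont: "continuous_on UNIV g" and nonneg: "\<And>x. 0 \<le> g x" and ab: "a < b"
  shows "(\<exists>x\<in>{a..b}. g x = 0) \<longleftrightarrow> (\<forall>n. \<exists>q\<in>\<rat> \<inter> {a..b}. g q < 1 / real (Suc n))"
proof
  assume "\<exists>x\<in>{a..b}. g x = 0"
  then obtain x where x: "x \<in> {a..b}" "g x = 0" by blast
  show "\<forall>n. \<exists>q\<in>\<rat> \<inter> {a..b}. g q < 1 / real (Suc n)"
  proof
    fix n
    let ?U = "{y. g y < 1 / real (Suc n)}"
    have U: "open ?U" using cont by (intro open_Collect_less) auto
    have "x \<in> closure {a<..<b}" using x ab by simp
    moreover have "x \<in> ?U" using x by simp
    ultimately have "?U \<inter> {a<..<b} \<noteq> {}" using open_Int_closure_eq_empty[OF U] by blast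
    moreover have "open (?U \<inter> {a<..<b})" using U by auto
    ultimately have "?U \<inter> {a<..<b} \<inter> \<rat> \<noteq> {}"
      using open_Int_closure_eq_empty[of "?U \<inter> {a<..<b}" \<rat>] Rats_closure_real by auto
    then show "\<exists>q\<in>\<rat> \<inter> {a..b}. g q < 1 / real (Suc n)" by force
  qed
next
  assume R: "\<forall>n. \<exists>q\<in>\<rat> \<inter> {a..b}. g q < 1 / real (Suc n)"
  have "continuous_on {a..b} g" using cont by (rule continuous_on_subset) simp
  then obtain x where x: "x \<in> {a..b}" "\<And>y. y \<in> {a..b} \<Longrightarrow> g x \<le> g y"
    using continuous_attains_inf[of "{a..b}" g] ab by auto
  have "g x < 1 / real (Suc n)" for n
    using R x(2) by (meson IntD2 le_less_trans)
  then have "g x \<le> 0"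
    by (metis not_le reals_Archimedean inverse_eq_divide less_asym)
  then show "\<exists>x\<in>{a..b}. g x = 0" using x nonneg[of x] by (intro bexI[of _ x]) auto
qed

lemma sets_grid_zero:
  assumes X: "X \<subseteq> trig_space \<nu>"
  shows "{v \<in> X. grid_zero v} \<in> sets (function_borel X)"
proof -
  note [measurable] = measurable_deriv[OF X]
  have "{v \<in> space (function_borel X). \<exists>k j. deriv v (grid k j) = 0} \<in> sets (function_borel X)"
    by measurable
  then show ?thesis by (simp add: grid_zero_def)
qed

lemma sets_degenerate:
  assumes X: "X \<subseteq> trig_space \<nu>"
  shows "{v \<in> X. degenerate v} \<in> sets (function_borel X)"
proof -
  note [measurable] = measurable_deriv[OF X]
  let ?g = "\<lambda>v \<theta>. \<bar>deriv v \<theta>\<bar> + \<bar>deriv (deriv v) \<theta>\<bar>"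
  have "degenerate v \<longleftrightarrow> (\<forall>n. \<exists>q\<in>\<rat> \<inter> {0..2*pi}. ?g v q < 1 / real (Suc n))" if "v \<in> X" for v
  proof -
    have v: "deriv v \<in> trig_space \<nu>" "deriv (deriv v) \<in> trig_space \<nu>"
      using that X trig_space_deriv(1) by blast+
    have "degenerate v \<longleftrightarrow> (\<exists>\<theta>\<in>{0..2*pi}. ?g v \<theta> = 0)"
      by (auto simp: degenerate_def add_nonneg_eq_0_iff)
    also have "\<dots> \<longleftrightarrow> (\<forall>n. \<exists>q\<in>\<rat> \<inter> {0..2*pi}. ?g v q < 1 / real (Suc n))"
      using v by (intro ex_zero_Icc_iff_rational continuous_intros continuous_on_trig_space) auto
    finally show ?thesis .
  qed
  then have "{v \<in> X. degenerate v}
      = {v \<in> space (function_borel X). \<forall>n. \<exists>q\<in>\<rat> \<inter> {0..2*pi}. ?g v q < 1 / real (Suc n)}"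
    by auto
  also have "\<dots> \<in> sets (function_borel X)"
  proof (intro sets.sets_Collect_countable_All sets.sets_Collect_countable_Ex')
    show "countable (\<rat> \<inter> {0..2*pi})" by (auto intro: countable_subset[OF _ countable_rat])
    show "{v \<in> space (function_borel X). ?g v q < 1 / real (Suc n)} \<in> sets (function_borel X)" for q n
      by measurable
  qed
  finally show ?thesis .
qed

lemma measurable_trig_sum: "trig_sum \<nu> \<in> lborel_Pi (modes \<nu>) \<rightarrow>\<^sub>M function_borel (trig_space \<nu>)"
  using measurable_trig_synthesis by (simp add: trig_sum_def[abs_def])

text \<open>The zero set of a nonzero linear form is null: in the direction of a coordinate with a nonzero
coefficient each line meets it in one point.\<close>

lemma AE_dot_nonzero:
  assumes "finite I" "i \<in> I" "u i \<noteq> 0"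
  shows "AE x in lborel_Pi I. dot I u x \<noteq> 0"
proof -
  have "(\<integral>\<^sup>+ x. indicator {0::real} (dot I u x) \<partial>lborel_Pi I)
     = (\<integral>\<^sup>+ x. \<integral>\<^sup>+ s. indicator {0::real} (dot I u (x(i := s))) \<partial>lborel \<partial>lborel_Pi (I - {i}))"
    using assms by (intro nn_integral_lborel_Pi_remove) auto
  also have "\<dots> = (\<integral>\<^sup>+ x. 0 \<partial>lborel_Pi (I - {i}))"
  proof (rule nn_integral_cong)
    fix x
    have "dot I u (x(i := s)) = u i * s + dot (I - {i}) u x" for s
      unfolding dot_def using assms by (subst sum.remove[of I i]) (auto intro!: sum.cong)
    then have "indicator {0::real} (dot I u (x(i := s))) = (indicator {- dot (I - {i}) u x / u i} s :: ennreal)" for s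
      using assms(3) by (auto simp: indicator_def field_simps add_eq_0_iff)
    then show "(\<integral>\<^sup>+ s. indicator {0::real} (dot I u (x(i := s))) \<partial>lborel) = 0" by simp
  qed
  finally have "(\<integral>\<^sup>+ x. indicator {0::real} (dot I u x) \<partial>lborel_Pi I) = 0" by simp
  moreover have "(\<lambda>x. indicator {0::real} (dot I u x) :: ennreal) \<in> borel_measurable (lborel_Pi I)"
    by measurable
  ultimately have "AE x in lborel_Pi I. indicator {0::real} (dot I u x) = (0::ennreal)"
    by (simp only: nn_integral_0_iff_AE)
  then show ?thesis by eventually_elim (auto simp: indicator_def)
qed

text \<open>The linear form \<open>a \<mapsto> v'(\<theta>)\<close> on the coefficients \<open>a\<close> of \<open>v\<close>, or the velocity of the curve
formed by the vectors \<open>(trig_basis k \<theta>)\<^sub>k\<close>.\<close>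

definition velocity :: "real \<Rightarrow> int \<Rightarrow> real" where
  "velocity \<theta> k = - of_int k * trig_basis (- k) \<theta>"

lemma deriv_trig_sum_eq_dot: "deriv (trig_sum \<nu> a) \<theta> = dot (modes \<nu>) (velocity \<theta>) a"
  unfolding deriv_trig_sum trig_sum_def dot_def velocity_def
  by (rule sum.reindex_bij_witness[of _ uminus uminus]) auto

lemma deriv_deriv_trig_sum_eq_dot:
  "deriv (deriv (trig_sum \<nu> a)) \<theta> = dot (modes \<nu>) (\<lambda>k. - (of_int k)\<^sup>2 * trig_basis k \<theta>) a"
  unfolding deriv_trig_sum trig_sum_def dot_def
  by (simp add: power2_eq_square mult_ac)

lemma AE_not_grid_zero:
  assumes "\<nu> \<ge> 1"
  shows "AE a in lborel_Pi (modes \<nu>). \<not> grid_zero (trig_sum \<nu> a)"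
proof -
  have "AE a in lborel_Pi (modes \<nu>). deriv (trig_sum \<nu> a) \<theta> \<noteq> 0" for \<theta>
  proof (cases "sin \<theta> = 0")
    case True
    then have "velocity \<theta> (-1) \<noteq> 0"
      using sin_zero_norm_cos_one[of \<theta>] by (auto simp: velocity_def trig_basis_def)
    then show ?thesis unfolding deriv_trig_sum_eq_dot using assms by (intro AE_dot_nonzero) auto
  next
    case False
    then have "velocity \<theta> 1 \<noteq> 0" by (auto simp: velocity_def trig_basis_def)
    then show ?thesis unfolding deriv_trig_sum_eq_dot using assms by (intro AE_dot_nonzero) auto
  qed
  then show ?thesis by (simp add: grid_zero_def AE_all_countable)
qed

lemma emeasure_lborel_negligible:
  assumes "S \<in> sets borel" "S \<subseteq> N" "negligible N"
  shows "emeasure lborel S = 0"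
proof -
  have "S \<in> null_sets (completion lborel)"
    using negligible_subset[OF assms(3,2)] by (simp add: negligible_iff_null_sets)
  then show ?thesis using assms(1) by (simp add: null_sets_completion_iff null_setsD1)
qed

text \<open>Fix all coefficients except those of \<open>cos \<theta>\<close> and \<open>sin \<theta>\<close>. For each \<open>\<theta>\<close> the equations
\<open>v'(\<theta>) = v''(\<theta>) = 0\<close> are two independent linear equations for these two coefficients. The pairs
of coefficients that admit a degenerate critical point therefore form a differentiable curve in the
plane, which is a null set; Tonelli's theorem gives the claim.\<close>

lemma AE_not_degenerate:
  assumes "\<nu> \<ge> 1"
  shows "AE a in lborel_Pi (modes \<nu>). \<not> degenerate (trig_sum \<nu> a)"
proof -
  let ?I = "modes \<nu>" and ?J = "modes \<nu> - {1, - 1}"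
  define Z where "Z = {a \<in> space (lborel_Pi ?I). degenerate (trig_sum \<nu> a)}"
  have "trig_sum \<nu> -` {v \<in> trig_space \<nu>. degenerate v} \<inter> space (lborel_Pi ?I) \<in> sets (lborel_Pi ?I)"
    by (rule measurable_sets[OF measurable_trig_sum sets_degenerate[OF subset_refl]])
  then have Z[measurable]: "Z \<in> sets (lborel_Pi ?I)"
    by (simp add: Z_def vimage_def Int_def trig_sum_in_trig_space conj_commute)
  have I: "(1::int) \<in> ?I" "(-1::int) \<in> ?I" "(1::int) \<noteq> - 1" using assms by auto
  have "emeasure (lborel_Pi ?I) Z = (\<integral>\<^sup>+ x. indicator Z x \<partial>lborel_Pi ?I)" by simp
  also have "\<dots> = (\<integral>\<^sup>+ x. \<integral>\<^sup>+ t. \<integral>\<^sup>+ s. indicator Z (x(- 1 := t, 1 := s)) \<partial>lborel \<partial>lborel \<partial>lborel_Pi ?J)"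
    using I by (intro nn_integral_lborel_Pi_remove2) auto
  also have "\<dots> = (\<integral>\<^sup>+ x. 0 \<partial>lborel_Pi ?J)"
  proof (rule nn_integral_cong)
    fix x assume x: "x \<in> space (lborel_Pi ?J)"
    let ?y = "\<lambda>(t, s). x(- 1 := t, 1 := s)"
    have y: "?y \<in> lborel \<Otimes>\<^sub>M lborel \<rightarrow>\<^sub>M lborel_Pi ?I"
    proof -
      have "?J \<union> {-1} \<union> {1} = ?I" using I by auto
      then show ?thesis unfolding case_prod_beta
        using x by (intro measurable_fun_upd[where J="?J \<union> {-1}"] measurable_fun_upd[where J="?J"]) auto
    qed
    have S: "?y -` Z \<in> sets (borel :: (real \<times> real) measure)"
    proof -
      have "?y -` Z \<inter> space (lborel \<Otimes>\<^sub>M lborel) \<in> sets (lborel \<Otimes>\<^sub>M lborel)"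
        by (rule measurable_sets[OF y Z])
      then show ?thesis by (simp only: lborel_prod sets_lborel space_lborel space_borel Int_UNIV_right)
    qed
    \<comment> \<open>\<open>G\<close> and \<open>G'\<close> are, up to the factor \<open>sqrt pi\<close>, the first and second derivative of the part of the sum
      whose coefficients are fixed.\<close>
    define G where "G = (\<lambda>\<theta>. sqrt pi * dot ?J (velocity \<theta>) x)"
    define G' where "G' = (\<lambda>\<theta>. sqrt pi * dot ?J (\<lambda>k. - (of_int k)\<^sup>2 * trig_basis k \<theta>) x)"
    \<comment> \<open>The solution of the two linear equations at \<open>\<theta>\<close>; their matrix is orthogonal.\<close>
    let ?c = "\<lambda>\<theta>. (G' \<theta> * sin \<theta> - G \<theta> * cos \<theta>, G \<theta> * sin \<theta> + G' \<theta> * cos \<theta>)"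
    have diff: "G differentiable at \<theta>" "G' differentiable at \<theta>" for \<theta>
    proof -
      have tb: "trig_basis k differentiable at \<theta>" for k
        using trig_basis_has_derivative real_differentiable_def by blast
      show "G differentiable at \<theta>" "G' differentiable at \<theta>"
        unfolding G_def G'_def dot_def velocity_def
        by (intro differentiable_mult differentiable_sum differentiable_const tb ballI finite_Diff
            finite_atLeastAtMost_int)+
    qed
    have "sin differentiable at \<theta>" "cos differentiable at \<theta>" for \<theta> :: real
      using DERIV_sin DERIV_cos real_differentiable_def by blast+
    then have "?c differentiable_on UNIV"
      unfolding differentiable_on_def
      using diff by (auto intro!: derivative_intros differentiable_Pair)
    then have neg: "negligible (?c ` UNIV)"
      by (intro negligible_differentiable_image_lowdim) simp_all
    have sub: "?y -` Z \<subseteq> ?c ` UNIV"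
    proof (rule subsetI, clarify)
      fix t s assume "x(- 1 := t, 1 := s) \<in> Z"
      then obtain \<theta> where \<theta>: "dot ?I (velocity \<theta>) (x(- 1 := t, 1 := s)) = 0"
        "dot ?I (\<lambda>k. - (of_int k)\<^sup>2 * trig_basis k \<theta>) (x(- 1 := t, 1 := s)) = 0"
        unfolding Z_def degenerate_def deriv_deriv_trig_sum_eq_dot deriv_trig_sum_eq_dot by blast
      have J: "dot ?J u (x(- 1 := t, 1 := s)) = dot ?J u x" for u
        unfolding dot_def by (intro sum.cong) auto
      have 1: "s * sin \<theta> - t * cos \<theta> = G \<theta>"
        using \<theta>(1) unfolding dot_split2[OF _ I, simplified] J G_def
        by (simp add: velocity_def trig_basis_def field_simps)
      have 2: "s * cos \<theta> + t * sin \<theta> = G' \<theta>"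
        using \<theta>(2) unfolding dot_split2[OF _ I, simplified] J G'_def
        by (simp add: trig_basis_def field_simps)
      have cs: "(cos \<theta>)\<^sup>2 = 1 - (sin \<theta>)\<^sup>2" by (simp add: cos_squared_eq)
      have "t = G' \<theta> * sin \<theta> - G \<theta> * cos \<theta>" "s = G \<theta> * sin \<theta> + G' \<theta> * cos \<theta>"
        unfolding 1[symmetric] 2[symmetric] using cs by algebra+
      then show "(t, s) \<in> range ?c" by (intro range_eqI[of _ _ \<theta>]) simp
    qed
    have "(\<integral>\<^sup>+ t. \<integral>\<^sup>+ s. indicator Z (x(- 1 := t, 1 := s)) \<partial>lborel \<partial>lborel)
        = (\<integral>\<^sup>+ t. \<integral>\<^sup>+ s. indicator (?y -` Z) (t, s) \<partial>lborel \<partial>lborel)"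
      by (simp add: indicator_def)
    also have "\<dots> = (\<integral>\<^sup>+ p. indicator (?y -` Z) p \<partial>(lborel \<Otimes>\<^sub>M lborel))"
      using S by (intro lborel.nn_integral_fst) (simp add: lborel_prod)
    also have "\<dots> = emeasure lborel (?y -` Z)"
      using S by (simp add: lborel_prod)
    also have "\<dots> = 0" by (rule emeasure_lborel_negligible[OF S sub neg])
    finally show "(\<integral>\<^sup>+ t. \<integral>\<^sup>+ s. indicator Z (x(- 1 := t, 1 := s)) \<partial>lborel \<partial>lborel) = 0" .
  qed
  finally have "emeasure (lborel_Pi ?I) Z = 0" by simp
  then show ?thesis using Z by (intro AE_I[of _ _ Z]) (auto simp: Z_def)
qed

section \<open>From the sphere to the ball\<close>

lemma circle_norm_trig_sum: "circle_norm (trig_sum \<nu> a) = sqrt (dot (modes \<nu>) a a)"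
proof -
  let ?I = "modes \<nu>"
  have int: "(\<lambda>\<theta>. trig_basis j \<theta> * trig_basis k \<theta>) integrable_on {0..2*pi}" for j k
    by (intro integrable_continuous_real continuous_intros continuous_on_trig_basis)
  have "circle_inner (trig_sum \<nu> a) (trig_sum \<nu> a)
      = integral {0..2*pi} (\<lambda>\<theta>. \<Sum>j\<in>?I. \<Sum>k\<in>?I. a j * a k * (trig_basis j \<theta> * trig_basis k \<theta>))"
    unfolding circle_inner_def trig_sum_def sum_product by (simp only: mult_ac)
  also have "\<dots> = (\<Sum>j\<in>?I. integral {0..2*pi} (\<lambda>\<theta>. \<Sum>k\<in>?I. a j * a k * (trig_basis j \<theta> * trig_basis k \<theta>)))"
    by (intro integral_sum finite_atLeastAtMost_int integrable_sum integrable_on_mult_right int)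
  also have "\<dots> = (\<Sum>j\<in>?I. \<Sum>k\<in>?I. integral {0..2*pi} (\<lambda>\<theta>. a j * a k * (trig_basis j \<theta> * trig_basis k \<theta>)))"
    by (intro sum.cong refl integral_sum finite_atLeastAtMost_int integrable_on_mult_right int)
  also have "\<dots> = (\<Sum>j\<in>?I. \<Sum>k\<in>?I. a j * a k * circle_inner (trig_basis j) (trig_basis k))"
    by (simp add: circle_inner_def)
  also have "\<dots> = dot ?I a a"
    by (simp add: trig_basis_orthonormal dot_def if_distrib[of "\<lambda>x. _ * x"] cong: if_cong)
  finally show ?thesis by (simp add: circle_norm_def)
qed

text \<open>The area measure is by definition the image of Lebesgue measure on the punctured ball under
normalisation, up to the factor \<open>dim (trig_space \<nu>)\<close>. Sets of critical points and sign changes are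
not affected by normalisation, so all later integrals are integrals over the ball of coefficients.\<close>

lemma nn_integral_sphere_area:
  assumes G: "G \<in> borel_measurable (function_borel (unit_sphere \<nu>))"
  shows "(\<integral>\<^sup>+ v. G v \<partial>sphere_area \<nu>) = of_nat (2 * \<nu> + 1) *
    (\<integral>\<^sup>+ a. G (\<lambda>\<theta>. trig_sum \<nu> a \<theta> / circle_norm (trig_sum \<nu> a)) * indicator (punctured_ball (modes \<nu>)) a
       \<partial>lborel_Pi (modes \<nu>))"
proof -
  let ?V = "trig_volume \<nu>" and ?D = "{v. 0 < circle_norm v \<and> circle_norm v \<le> 1}"
  let ?N = "\<lambda>v (\<theta>::real). v \<theta> / circle_norm v"
  have V: "?V = distr (lborel_Pi (modes \<nu>)) (function_borel (trig_space \<nu>)) (trig_sum \<nu>)"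
    by (simp add: trig_volume_def trig_sum_def[abs_def])
  have sV: "sets ?V = sets (function_borel (trig_space \<nu>))" and spV: "space ?V = trig_space \<nu>"
    by (simp_all add: V)
  note cn = measurable_circle_norm[of \<nu>, folded measurable_cong_sets[OF sV refl]]
  have D: "?D \<inter> space ?V \<in> sets ?V"
  proof -
    have "{v \<in> space ?V. 0 < circle_norm v \<and> circle_norm v \<le> 1} \<in> sets ?V"
      using cn by measurable
    then show ?thesis by (simp add: Int_def conj_commute)
  qed
  have N: "?N \<in> restrict_space ?V ?D \<rightarrow>\<^sub>M function_borel (unit_sphere \<nu>)"
  proof (rule measurable_function_borelI)
    fix \<theta>
    have "(\<lambda>v. v \<theta>) \<in> borel_measurable ?V"
      using measurable_eval[of \<theta> "trig_space \<nu>"] by (simp add: measurable_cong_sets[OF sV refl])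
    with cn show "(\<lambda>v. v \<theta> / circle_norm v) \<in> borel_measurable (restrict_space ?V ?D)"
      by (intro measurable_restrict_space1) simp
  next
    fix v assume "v \<in> space (restrict_space ?V ?D)"
    then have v: "v \<in> trig_space \<nu>" "0 < circle_norm v" by (auto simp: space_restrict_space spV)
    then show "?N v \<in> unit_sphere \<nu>"
      using trig_space_scale[OF v(1), of "1 / circle_norm v"]
        circle_norm_scale[of "1 / circle_norm v" v]
      by (simp add: unit_sphere_def)
  qed
  have GN: "(\<lambda>v. G (?N v) * indicator ?D v) \<in> borel_measurable ?V"
    using measurable_compose[OF N G] by (simp add: borel_measurable_restrict_space_iff_ennreal[OF D])
  have "(\<integral>\<^sup>+ v. G v \<partial>sphere_area \<nu>)
      = of_nat (2 * \<nu> + 1) * (\<integral>\<^sup>+ v. G v \<partial>distr (restrict_space ?V ?D) (function_borel (unit_sphere \<nu>)) ?N)"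
    using G unfolding sphere_area_def dim_trig_space by (intro nn_integral_scale_measure) simp
  also have "(\<integral>\<^sup>+ v. G v \<partial>distr (restrict_space ?V ?D) (function_borel (unit_sphere \<nu>)) ?N)
      = (\<integral>\<^sup>+ v. G (?N v) * indicator ?D v \<partial>?V)"
    by (subst nn_integral_distr[OF N]) (use G D in \<open>simp_all add: nn_integral_restrict_space\<close>)
  also have "\<dots> = (\<integral>\<^sup>+ a. G (?N (trig_sum \<nu> a)) * indicator ?D (trig_sum \<nu> a) \<partial>lborel_Pi (modes \<nu>))"
    using GN unfolding measurable_cong_sets[OF sV refl] unfolding V
    by (intro nn_integral_distr measurable_trig_sum) simp
  also have "\<dots> = (\<integral>\<^sup>+ a. G (?N (trig_sum \<nu> a)) * indicator (punctured_ball (modes \<nu>)) a \<partial>lborel_Pi (modes \<nu>))"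
    by (intro nn_integral_cong) (simp add: indicator_def punctured_ball_def circle_norm_trig_sum)
  finally show ?thesis .
qed

lemma sets_sphere_area [simp]: "sets (sphere_area \<nu>) = sets (function_borel (unit_sphere \<nu>))"
  and space_sphere_area [simp]: "space (sphere_area \<nu>) = unit_sphere \<nu>"
  by (simp_all add: sphere_area_def space_scale_measure)

lemma unit_sphere_subset: "unit_sphere \<nu> \<subseteq> trig_space \<nu>"
  by (auto simp: unit_sphere_def)

lemma deriv_divide_const:
  assumes "v \<in> trig_space \<nu>"
  shows "deriv (\<lambda>\<theta>. v \<theta> / c) = (\<lambda>\<theta>. deriv v \<theta> / c)"
  by (intro ext DERIV_imp_deriv DERIV_cdivide trig_space_deriv(2)[OF assms])

lemma deriv_deriv_divide_const:
  assumes "v \<in> trig_space \<nu>"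
  shows "deriv (\<lambda>\<theta>. deriv v \<theta> / c) = (\<lambda>\<theta>. deriv (deriv v) \<theta> / c)"
  by (rule deriv_divide_const[OF trig_space_deriv(1)[OF assms]])

lemma AE_sphere_area_regular:
  assumes "\<nu> \<ge> 1"
  shows "AE v in sphere_area \<nu>. \<not> grid_zero v \<and> \<not> degenerate v"
proof -
  let ?B = "{v \<in> unit_sphere \<nu>. grid_zero v} \<union> {v \<in> unit_sphere \<nu>. degenerate v}"
  have B: "?B \<in> sets (function_borel (unit_sphere \<nu>))"
    by (intro sets.Un sets_grid_zero[OF unit_sphere_subset] sets_degenerate[OF unit_sphere_subset])
  have "emeasure (sphere_area \<nu>) ?B = (\<integral>\<^sup>+ v. indicator ?B v \<partial>sphere_area \<nu>)"
    using B by simp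
  also have "\<dots> = of_nat (2 * \<nu> + 1) *
    (\<integral>\<^sup>+ a. indicator ?B (\<lambda>\<theta>. trig_sum \<nu> a \<theta> / circle_norm (trig_sum \<nu> a)) * indicator (punctured_ball (modes \<nu>)) a
       \<partial>lborel_Pi (modes \<nu>))"
    using B by (intro nn_integral_sphere_area) simp
  also have "(\<integral>\<^sup>+ a. indicator ?B (\<lambda>\<theta>. trig_sum \<nu> a \<theta> / circle_norm (trig_sum \<nu> a)) * indicator (punctured_ball (modes \<nu>)) a
       \<partial>lborel_Pi (modes \<nu>)) = (\<integral>\<^sup>+ a. 0 \<partial>lborel_Pi (modes \<nu>))"
  proof (rule nn_integral_cong_AE)
    show "AE a in lborel_Pi (modes \<nu>).
      indicator ?B (\<lambda>\<theta>. trig_sum \<nu> a \<theta> / circle_norm (trig_sum \<nu> a)) * indicator (punctured_ball (modes \<nu>)) a = (0::ennreal)"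
      using AE_not_grid_zero[OF assms] AE_not_degenerate[OF assms]
    proof eventually_elim
      case (elim a)
      show ?case
      proof (cases "a \<in> punctured_ball (modes \<nu>)")
        case True
        define c where "c = circle_norm (trig_sum \<nu> a)"
        have "c \<noteq> 0" using True by (simp add: c_def circle_norm_trig_sum punctured_ball_def)
        then have "\<not> grid_zero (\<lambda>\<theta>. trig_sum \<nu> a \<theta> / c)" "\<not> degenerate (\<lambda>\<theta>. trig_sum \<nu> a \<theta> / c)"
          using elim
          by (simp_all add: grid_zero_def degenerate_def deriv_deriv_divide_const[OF trig_sum_in_trig_space]
              deriv_divide_const[OF trig_sum_in_trig_space])
        then show ?thesis by (simp add: c_def)
      qed simp
    qed
  qed
  finally have "emeasure (sphere_area \<nu>) ?B = 0" by simp
  then show ?thesis using B by (intro AE_I[of _ _ ?B]) auto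
qed

section \<open>The expected number of sign changes on a grid\<close>

lemma dot_add_left: "dot I (\<lambda>k. u k + v k) x = dot I u x + dot I v x"
  by (simp add: dot_def distrib_right sum.distrib)

lemma dot_diff_left: "dot I (\<lambda>k. u k - v k) x = dot I u x - dot I v x"
  by (simp add: dot_def left_diff_distrib sum_subtractf)

lemma dot_add_right: "dot I x (\<lambda>k. u k + v k) = dot I x u + dot I x v"
  by (simp add: dot_def distrib_left sum.distrib)

lemma dot_diff_right: "dot I x (\<lambda>k. u k - v k) = dot I x u - dot I x v"
  by (simp add: dot_def right_diff_distrib sum_subtractf)

lemma sum_modes:
  "(\<Sum>k\<in>modes \<nu>. g k) = g 0 + (\<Sum>m=1..\<nu>. g (int m) + g (- int m))" for g :: "int \<Rightarrow> real"
proof (induction \<nu>)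
  case (Suc \<nu>)
  have "modes (Suc \<nu>) = insert (int (Suc \<nu>)) (insert (- int (Suc \<nu>)) (modes \<nu>))" by auto
  then have "(\<Sum>k\<in>modes (Suc \<nu>). g k) = g (int (Suc \<nu>)) + (g (- int (Suc \<nu>)) + (\<Sum>k\<in>modes \<nu>. g k))"
    by simp
  then show ?case by (simp add: Suc.IH)
qed simp

text \<open>The inner product of two velocity vectors depends only on the difference of their parameters. It
is the covariance function of \<open>v'\<close> when the coefficients of \<open>v\<close> are independent standard normal
variables.\<close>

definition covariance :: "nat \<Rightarrow> real \<Rightarrow> real" where
  "covariance \<nu> h = (\<Sum>m=1..\<nu>. (real m)\<^sup>2 * cos (real m * h)) / pi"

lemma dot_velocity: "dot (modes \<nu>) (velocity \<alpha>) (velocity \<beta>) = covariance \<nu> (\<beta> - \<alpha>)"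
proof -
  have "velocity \<alpha> (int m) * velocity \<beta> (int m) + velocity \<alpha> (- int m) * velocity \<beta> (- int m)
      = (real m)\<^sup>2 * cos (real m * (\<beta> - \<alpha>)) / pi" if "m \<in> {1..\<nu>}" for m
    using that by (simp add: velocity_def trig_basis_def right_diff_distrib cos_diff power2_eq_square field_simps)
  then show ?thesis
    unfolding dot_def sum_modes covariance_def by (simp add: velocity_def sum_divide_distrib)
qed

lemma sum_squares_trig_pos:
  assumes "\<nu> \<ge> 1" "\<And>m. 0 \<le> g m" "0 < g (1::nat)"
  shows "0 < (\<Sum>m=1..\<nu>. (real m)\<^sup>2 * g m)"
  using assms by (intro sum_pos2[of _ 1]) auto

lemma covariance_bounds:
  assumes "\<nu> \<ge> 1" "0 < h" "h < pi"
  shows "0 < covariance \<nu> 0 - covariance \<nu> h" "0 < covariance \<nu> 0 + covariance \<nu> h"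
proof -
  have "cos h < cos 0" using assms by (intro cos_monotone_0_pi) auto
  then have "0 < (\<Sum>m=1..\<nu>. (real m)\<^sup>2 * (1 - cos (real m * h)))"
    using assms by (intro sum_squares_trig_pos) auto
  then show "0 < covariance \<nu> 0 - covariance \<nu> h"
    by (simp add: covariance_def right_diff_distrib sum_subtractf flip: diff_divide_distrib)
  have cos_minus_one_le: "0 \<le> 1 + cos x" for x :: real using cos_ge_minus_one[of x] by linarith
  have "cos pi < cos h" using assms by (intro cos_monotone_0_pi) auto
  then have "0 < (\<Sum>m=1..\<nu>. (real m)\<^sup>2 * (1 + cos (real m * h)))"
    using assms(1) by (intro sum_squares_trig_pos) (simp_all add: cos_minus_one_le)
  then show "0 < covariance \<nu> 0 + covariance \<nu> h"
    by (simp add: covariance_def distrib_left sum.distrib flip: add_divide_distrib)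
qed

text \<open>The probability that \<open>v'\<close> has opposite signs at two points of distance \<open>h\<close>. If \<open>\<omega>\<close> is the
angle between the two velocity vectors, then the square root is \<open>tan (\<omega> / 2)\<close> and the
probability is \<open>\<omega> / \<pi>\<close>.\<close>

definition crossing_probability :: "nat \<Rightarrow> real \<Rightarrow> real" where
  "crossing_probability \<nu> h =
     2 / pi * arctan (sqrt ((covariance \<nu> 0 - covariance \<nu> h) / (covariance \<nu> 0 + covariance \<nu> h)))"

text \<open>\<open>X Y < 0\<close> holds if and only if \<open>\<bar>X + Y\<bar> < \<bar>X - Y\<bar>\<close>. The two velocity vectors have equal length,
so their sum and their difference are orthogonal, and the event is a sector of the ball.\<close>

lemma emeasure_sign_change:
  assumes "\<nu> \<ge> 1" "0 < \<beta> - \<alpha>" "\<beta> - \<alpha> < pi"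
  shows "emeasure (lborel_Pi (modes \<nu>))
      {a \<in> punctured_ball (modes \<nu>). deriv (trig_sum \<nu> a) \<alpha> * deriv (trig_sum \<nu> a) \<beta> < 0}
    = ennreal (crossing_probability \<nu> (\<beta> - \<alpha>)) * emeasure (lborel_Pi (modes \<nu>)) (punctured_ball (modes \<nu>))"
proof -
  let ?I = "modes \<nu>"
  define p where "p = (\<lambda>k. velocity \<alpha> k + velocity \<beta> k)"
  define q where "q = (\<lambda>k. velocity \<alpha> k - velocity \<beta> k)"
  have even: "covariance \<nu> (\<alpha> - \<beta>) = covariance \<nu> (\<beta> - \<alpha>)"
    by (metis dot_commute dot_velocity)
  note expand = p_def q_def dot_add_left dot_add_right dot_diff_left dot_diff_right dot_velocity even
  have pq: "dot ?I p q = 0" unfolding expand by simp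
  have pp: "dot ?I p p = 2 * (covariance \<nu> 0 + covariance \<nu> (\<beta> - \<alpha>))" unfolding expand by simp
  have qq: "dot ?I q q = 2 * (covariance \<nu> 0 - covariance \<nu> (\<beta> - \<alpha>))" unfolding expand by simp
  have "X * Y < 0 \<longleftrightarrow> \<bar>X + Y\<bar> < \<bar>X - Y\<bar>" for X Y :: real
  proof -
    have "\<bar>X + Y\<bar> < \<bar>X - Y\<bar> \<longleftrightarrow> (X + Y)\<^sup>2 < (X - Y)\<^sup>2" by (metis abs_le_square_iff not_le)
    also have "(X + Y)\<^sup>2 < (X - Y)\<^sup>2 \<longleftrightarrow> X * Y < 0" by (simp add: power2_eq_square algebra_simps)
    finally show ?thesis by simp
  qed
  then have "{a \<in> punctured_ball ?I. deriv (trig_sum \<nu> a) \<alpha> * deriv (trig_sum \<nu> a) \<beta> < 0}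
      = {a \<in> punctured_ball ?I. \<bar>dot ?I p a\<bar> < \<bar>dot ?I q a\<bar>}"
    by (simp add: deriv_trig_sum_eq_dot p_def q_def dot_add_left dot_diff_left)
  moreover have "dot ?I p p > 0" "dot ?I q q > 0"
    unfolding pp qq using covariance_bounds[OF assms] by simp_all
  ultimately have "emeasure (lborel_Pi ?I)
      {a \<in> punctured_ball ?I. deriv (trig_sum \<nu> a) \<alpha> * deriv (trig_sum \<nu> a) \<beta> < 0}
    = ennreal (2 / pi * arctan (sqrt (dot ?I q q / dot ?I p p))) * emeasure (lborel_Pi ?I) (punctured_ball ?I)"
    by (simp only: emeasure_sector[OF finite_atLeastAtMost_int pq])
  also have "dot ?I q q / dot ?I p p
      = (covariance \<nu> 0 - covariance \<nu> (\<beta> - \<alpha>)) / (covariance \<nu> 0 + covariance \<nu> (\<beta> - \<alpha>))"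
    unfolding pp qq by (rule mult_divide_mult_cancel_left) simp
  finally show ?thesis by (simp only: crossing_probability_def)
qed

lemma sign_changes_scale:
  assumes "c \<noteq> 0"
  shows "sign_changes (\<lambda>\<theta>. f \<theta> / c) k = sign_changes f k"
proof -
  have "f x / c * (f y / c) < 0 \<longleftrightarrow> f x * f y < 0" for x y
  proof -
    have "f x / c * (f y / c) = f x * f y / c\<^sup>2" by (simp add: power2_eq_square)
    moreover have "0 < c\<^sup>2" using assms by simp
    ultimately show ?thesis by (simp only: divide_less_0_iff) auto
  qed
  then show ?thesis by (simp only: sign_changes_def)
qed

lemma sign_changes_eq_sum:
  "of_nat (sign_changes f k) = (\<Sum>j<2 ^ k. indicator {x. x < 0} (f (grid k j) * f (grid k (Suc j))) :: ennreal)"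
proof -
  let ?P = "\<lambda>j. f (grid k j) * f (grid k (Suc j)) < 0"
  have "(\<Sum>j<2 ^ k. indicator {x. x < 0} (f (grid k j) * f (grid k (Suc j))) :: ennreal)
      = (\<Sum>j\<in>{..<2 ^ k}. if ?P j then 1 else 0)"
    by (simp only: indicator_def mem_Collect_eq of_bool_def)
  also have "\<dots> = of_nat (card ({..<2 ^ k} \<inter> {j. ?P j}))"
    by (subst sum.If_cases) simp_all
  also have "{..<2 ^ k} \<inter> {j. ?P j} = {j. j < 2 ^ k \<and> ?P j}" by auto
  finally show ?thesis by (simp only: sign_changes_def)
qed

lemma measurable_sign_changes:
  assumes X: "X \<subseteq> trig_space \<nu>"
  shows "(\<lambda>v. of_nat (sign_changes (deriv v) k) :: ennreal) \<in> borel_measurable (function_borel X)"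
proof -
  note [measurable] = measurable_deriv[OF X]
  show ?thesis unfolding sign_changes_eq_sum by measurable
qed

lemma emeasure_sphere_area_unit_sphere:
  "emeasure (sphere_area \<nu>) (unit_sphere \<nu>)
     = of_nat (2 * \<nu> + 1) * emeasure (lborel_Pi (modes \<nu>)) (punctured_ball (modes \<nu>))"
proof -
  have "emeasure (sphere_area \<nu>) (unit_sphere \<nu>) = (\<integral>\<^sup>+ v. 1 \<partial>sphere_area \<nu>)"
    by simp
  also have "\<dots> = of_nat (2 * \<nu> + 1) * (\<integral>\<^sup>+ a. 1 * indicator (punctured_ball (modes \<nu>)) a \<partial>lborel_Pi (modes \<nu>))"
    by (intro nn_integral_sphere_area) simp
  finally show ?thesis by simp
qed

text \<open>From \<open>k = 2\<close> on the mesh is below \<open>\<pi>\<close>, which keeps the velocity vectors at neighbouring grid points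
linearly independent.\<close>

lemma nn_integral_sign_changes:
  assumes \<nu>: "\<nu> \<ge> 1" and k: "k \<ge> 2"
  shows "(\<integral>\<^sup>+ v. of_nat (sign_changes (deriv v) k) \<partial>sphere_area \<nu>)
    = ennreal (2 ^ k * crossing_probability \<nu> (2 * pi / 2 ^ k)) * emeasure (sphere_area \<nu>) (unit_sphere \<nu>)"
proof -
  let ?I = "modes \<nu>" and ?h = "2 * pi / 2 ^ k"
  let ?B = "emeasure (lborel_Pi ?I) (punctured_ball ?I)"
  let ?E = "\<lambda>j. {a \<in> punctured_ball ?I. deriv (trig_sum \<nu> a) (grid k j) * deriv (trig_sum \<nu> a) (grid k (Suc j)) < 0}"
  have "(2::real) ^ 2 \<le> 2 ^ k" using k by (intro power_increasing) auto
  then have h: "0 < ?h" "?h < pi" by (simp_all add: divide_less_eq)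
  have step: "grid k (Suc j) - grid k j = ?h" for j by (simp add: grid_def field_simps)
  have nonneg: "0 \<le> crossing_probability \<nu> ?h"
    using covariance_bounds[OF \<nu> h] by (simp add: crossing_probability_def)
  have E: "?E j \<in> sets (lborel_Pi ?I)" for j
    unfolding deriv_trig_sum_eq_dot by (intro sets_punctured_ball_Collect) measurable
  have "(\<integral>\<^sup>+ v. of_nat (sign_changes (deriv v) k) \<partial>sphere_area \<nu>)
    = of_nat (2 * \<nu> + 1) * (\<integral>\<^sup>+ a. of_nat (sign_changes (deriv (\<lambda>\<theta>. trig_sum \<nu> a \<theta> / circle_norm (trig_sum \<nu> a))) k)
        * indicator (punctured_ball ?I) a \<partial>lborel_Pi ?I)"
    by (intro nn_integral_sphere_area measurable_sign_changes[OF unit_sphere_subset])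
  also have "(\<integral>\<^sup>+ a. of_nat (sign_changes (deriv (\<lambda>\<theta>. trig_sum \<nu> a \<theta> / circle_norm (trig_sum \<nu> a))) k)
        * indicator (punctured_ball ?I) a \<partial>lborel_Pi ?I)
    = (\<integral>\<^sup>+ a. (\<Sum>j<2 ^ k. indicator (?E j) a) \<partial>lborel_Pi ?I)"
  proof (rule nn_integral_cong)
    fix a assume "a \<in> space (lborel_Pi ?I)"
    show "of_nat (sign_changes (deriv (\<lambda>\<theta>. trig_sum \<nu> a \<theta> / circle_norm (trig_sum \<nu> a))) k)
        * indicator (punctured_ball ?I) a = (\<Sum>j<2 ^ k. indicator (?E j) a :: ennreal)"
    proof (cases "a \<in> punctured_ball ?I")
      case True
      then have "circle_norm (trig_sum \<nu> a) \<noteq> 0" by (simp add: circle_norm_trig_sum punctured_ball_def)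
      then show ?thesis
        using True trig_sum_in_trig_space[of \<nu> a]
        by (simp add: deriv_divide_const sign_changes_scale sign_changes_eq_sum indicator_def)
    qed simp
  qed
  also have "\<dots> = (\<Sum>j<2 ^ k. emeasure (lborel_Pi ?I) (?E j))"
    using E by (subst nn_integral_sum) auto
  also have "\<dots> = (\<Sum>j<(2::nat) ^ k. ennreal (crossing_probability \<nu> ?h) * ?B)"
    using h by (intro sum.cong refl) (simp add: emeasure_sign_change[OF \<nu>] step)
  also have "\<dots> = ennreal (2 ^ k * crossing_probability \<nu> ?h) * ?B"
    using nonneg by (simp add: ennreal_mult' mult.assoc flip: ennreal_power)
  finally show ?thesis by (simp add: emeasure_sphere_area_unit_sphere mult_ac)
qed

section \<open>The limit of fine grids\<close>

lemma tendsto_arctan_over_self: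
  assumes "(f \<longlongrightarrow> 0) F" "eventually (\<lambda>x. f x \<noteq> 0) F"
  shows "((\<lambda>x. arctan (f x) / f x) \<longlongrightarrow> 1) F"
proof -
  have "(\<lambda>h. (arctan (0 + h) - arctan 0) / h) \<midarrow>0\<rightarrow> inverse (1 + 0\<^sup>2)"
    using DERIV_arctan[of 0] by (simp only: DERIV_def)
  then have "((\<lambda>h. arctan h / h) \<longlongrightarrow> 1) (at 0)" by simp
  moreover have "filterlim f (at 0) F" using assms by (simp add: filterlim_at)
  ultimately show ?thesis by (rule filterlim_compose)
qed

lemma tendsto_one_minus_cos:
  fixes c :: real
  shows "((\<lambda>h. (1 - cos (c * h)) / h\<^sup>2) \<longlongrightarrow> c\<^sup>2 / 2) (at_right 0)"
proof (cases "c = 0")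
  case False
  have "((\<lambda>h. (1 - cos (\<bar>c\<bar> * h)) / h\<^sup>2) \<longlongrightarrow> \<bar>c\<bar> * \<bar>c\<bar> / 2) (at_right 0)"
    using False by real_asymp
  moreover have "cos (\<bar>c\<bar> * h) = cos (c * h)" for h by (simp add: abs_if)
  ultimately show ?thesis by (simp add: power2_eq_square)
qed simp

text \<open>For small \<open>h\<close> the tangent in the crossing probability is \<open>h / 2\<close> times the square root of
\<open>(\<Sum>m. m\<^sup>4) / (\<Sum>m. m\<^sup>2)\<close>, because \<open>1 - cos (m h)\<close> is asymptotic to \<open>m\<^sup>2 h\<^sup>2 / 2\<close>. The factor
\<open>2 \<pi> / h\<close> is the number of grid intervals.\<close>

lemma tendsto_crossing_probability:
  assumes \<nu>: "\<nu> \<ge> 1"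
  shows "((\<lambda>h. 2 * pi / h * crossing_probability \<nu> h) \<longlongrightarrow>
     2 * sqrt ((\<Sum>m=1..\<nu>. real m ^ 4) / (\<Sum>m=1..\<nu>. real m ^ 2))) (at_right 0)"
proof -
  define S2 where "S2 = (\<Sum>m=1..\<nu>. real m ^ 2)"
  define S4 where "S4 = (\<Sum>m=1..\<nu>. real m ^ 4)"
  have S2: "S2 > 0" unfolding S2_def using \<nu> by (intro sum_pos2[of _ 1]) auto
  let ?C = "covariance \<nu>"
  define t where "t = (\<lambda>h. sqrt ((?C 0 - ?C h) / (?C 0 + ?C h)))"
  have near: "eventually (\<lambda>h. 0 < h \<and> h < pi) (at_right (0::real))"
    using eventually_at_right_less eventually_at_right_real[OF pi_gt_zero] by (auto elim: eventually_mono)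
  have "((\<lambda>h. \<Sum>m=1..\<nu>. (real m)\<^sup>2 * ((1 - cos (real m * h)) / h\<^sup>2)) \<longlongrightarrow> (\<Sum>m=1..\<nu>. (real m)\<^sup>2 * ((real m)\<^sup>2 / 2))) (at_right 0)"
    by (intro tendsto_sum tendsto_mult tendsto_const tendsto_one_minus_cos)
  then have "((\<lambda>h. (\<Sum>m=1..\<nu>. (real m)\<^sup>2 * ((1 - cos (real m * h)) / h\<^sup>2)) / pi) \<longlongrightarrow> (\<Sum>m=1..\<nu>. (real m)\<^sup>2 * ((real m)\<^sup>2 / 2)) / pi) (at_right 0)"
    by (intro tendsto_divide tendsto_const) auto
  moreover have "(\<Sum>m=1..\<nu>. (real m)\<^sup>2 * ((1 - cos (real m * h)) / h\<^sup>2)) / pi = (?C 0 - ?C h) / h\<^sup>2" for h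
    by (simp add: covariance_def right_diff_distrib diff_divide_distrib sum_subtractf sum_divide_distrib mult.commute)
  moreover have "(\<Sum>m=1..\<nu>. (real m)\<^sup>2 * ((real m)\<^sup>2 / 2)) / pi = S4 / (2 * pi)"
    by (simp add: S4_def sum_divide_distrib power4_eq_xxxx power2_eq_square mult.assoc)
  ultimately have num: "((\<lambda>h. (?C 0 - ?C h) / h\<^sup>2) \<longlongrightarrow> S4 / (2 * pi)) (at_right 0)" by simp
  have "isCont ?C 0" unfolding covariance_def[abs_def] by (intro continuous_intros) auto
  then have "(?C \<longlongrightarrow> ?C 0) (at_right 0)"
    by (auto simp: isCont_def intro: tendsto_mono[OF at_le])
  then have "((\<lambda>h. ?C 0 + ?C h) \<longlongrightarrow> ?C 0 + ?C 0) (at_right 0)"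
    by (intro tendsto_add tendsto_const)
  moreover have "?C 0 = S2 / pi" by (simp add: covariance_def S2_def)
  ultimately have den: "((\<lambda>h. ?C 0 + ?C h) \<longlongrightarrow> 2 * S2 / pi) (at_right 0)" by simp
  have lim: "((\<lambda>h. sqrt ((?C 0 - ?C h) / h\<^sup>2 / (?C 0 + ?C h))) \<longlongrightarrow> sqrt (S4 / (2 * pi) / (2 * S2 / pi))) (at_right 0)"
    using S2 by (intro tendsto_real_sqrt tendsto_divide num den) auto
  have half: "sqrt (S4 / (2 * pi) / (2 * S2 / pi)) = sqrt (S4 / S2) / 2"
  proof -
    have "S4 / (2 * pi) / (2 * S2 / pi) = S4 / S2 / 2\<^sup>2" using S2 by (simp add: field_simps)
    then show ?thesis by (simp only: real_sqrt_divide[of "S4 / S2"]) simp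
  qed
  have "eventually (\<lambda>h. sqrt ((?C 0 - ?C h) / h\<^sup>2 / (?C 0 + ?C h)) = t h / h) (at_right 0)"
    using near
  proof eventually_elim
    case (elim h)
    have "(?C 0 - ?C h) / h\<^sup>2 / (?C 0 + ?C h) = (?C 0 - ?C h) / (?C 0 + ?C h) / h\<^sup>2" by simp
    then show ?case using elim by (simp only: t_def real_sqrt_divide real_sqrt_abs) simp
  qed
  then have th: "((\<lambda>h. t h / h) \<longlongrightarrow> sqrt (S4 / S2) / 2) (at_right 0)"
    by (rule Lim_transform_eventually[OF lim[unfolded half]])
  have tpos: "eventually (\<lambda>h. t h \<noteq> 0) (at_right 0)"
    using near by eventually_elim (use covariance_bounds[OF \<nu>] in \<open>force simp: t_def\<close>)
  have "((\<lambda>h. t h / h * h) \<longlongrightarrow> sqrt (S4 / S2) / 2 * 0) (at_right 0)"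
    by (intro tendsto_mult th tendsto_ident_at)
  moreover have "eventually (\<lambda>h. t h / h * h = t h) (at_right 0)"
    using near by eventually_elim auto
  ultimately have t0: "(t \<longlongrightarrow> 0) (at_right 0)" by (simp add: tendsto_cong)
  have "((\<lambda>h. 4 * (t h / h) * (arctan (t h) / t h)) \<longlongrightarrow> 4 * (sqrt (S4 / S2) / 2) * 1) (at_right 0)"
    by (intro tendsto_mult tendsto_const th tendsto_arctan_over_self t0 tpos)
  moreover have "eventually (\<lambda>h. 4 * (t h / h) * (arctan (t h) / t h) = 2 * pi / h * crossing_probability \<nu> h) (at_right 0)"
    using tpos by eventually_elim (simp add: crossing_probability_def t_def)
  ultimately show ?thesis by (simp add: tendsto_cong S2_def S4_def)
qed

text \<open>An exact formula for every \<open>\<nu> \<ge> 1\<close>. Sign changes increase to the number of critical points under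
refinement of the grid, so monotone convergence exchanges the limit and the integral.\<close>

lemma expected_critical_points_eq:
  assumes \<nu>: "\<nu> \<ge> 1"
  shows "expected_critical_points \<nu>
    = ennreal (2 * sqrt ((\<Sum>m=1..\<nu>. real m ^ 4) / (\<Sum>m=1..\<nu>. real m ^ 2)))"
proof -
  let ?A = "emeasure (sphere_area \<nu>) (unit_sphere \<nu>)"
  let ?L = "2 * sqrt ((\<Sum>m=1..\<nu>. real m ^ 4) / (\<Sum>m=1..\<nu>. real m ^ 2))"
  let ?s = "\<lambda>k v. of_nat (sign_changes (deriv v) k) :: ennreal"
  have A: "?A \<noteq> 0" "?A \<noteq> top"
    using emeasure_punctured_ball_pos[of "modes \<nu>"] emeasure_punctured_ball_finite[of "modes \<nu>"]
    by (auto simp: emeasure_sphere_area_unit_sphere ennreal_mult_eq_top_iff of_nat_less_top)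
  note reg = AE_sphere_area_regular[OF \<nu>]
  have meas: "?s k \<in> borel_measurable (sphere_area \<nu>)" for k
    using measurable_sign_changes[OF unit_sphere_subset] by (simp add: measurable_cong_sets[OF sets_sphere_area refl])
  have mono: "AE v in sphere_area \<nu>. ?s k v \<le> ?s (Suc k) v" for k
    using reg by eventually_elim (auto simp: grid_zero_def intro!: sign_changes_mono)
  have "AE v in sphere_area \<nu>. num_critical_points v = (SUP k. ?s k v)"
    using reg AE_space
    by eventually_elim (use unit_sphere_subset in \<open>auto intro!: num_critical_points_eq_SUP\<close>)
  then have "(\<integral>\<^sup>+ v. num_critical_points v \<partial>sphere_area \<nu>) = (\<integral>\<^sup>+ v. (SUP k. ?s k v) \<partial>sphere_area \<nu>)"
    by (rule nn_integral_cong_AE)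
  also have "\<dots> = (SUP k. \<integral>\<^sup>+ v. ?s k v \<partial>sphere_area \<nu>)"
    by (intro nn_integral_monotone_convergence_SUP_AE mono meas)
  also have "\<dots> = ennreal ?L * ?A"
  proof (rule LIMSEQ_unique)
    show "(\<lambda>k. \<integral>\<^sup>+ v. ?s k v \<partial>sphere_area \<nu>) \<longlonglongrightarrow> (SUP k. \<integral>\<^sup>+ v. ?s k v \<partial>sphere_area \<nu>)"
      by (intro LIMSEQ_SUP incseq_SucI nn_integral_mono_AE mono)
    have h: "filterlim (\<lambda>k. 2 * pi / 2 ^ k) (at_right 0) sequentially" by real_asymp
    have "(\<lambda>k. 2 * pi / (2 * pi / 2 ^ k) * crossing_probability \<nu> (2 * pi / 2 ^ k)) \<longlonglongrightarrow> ?L"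
      by (rule filterlim_compose[OF tendsto_crossing_probability[OF \<nu>] h])
    then have "(\<lambda>k. ennreal (2 ^ k * crossing_probability \<nu> (2 * pi / 2 ^ k)) * ?A) \<longlonglongrightarrow> ennreal ?L * ?A"
      using A by (intro tendsto_mult_ennreal tendsto_ennrealI tendsto_const) auto
    moreover have "eventually (\<lambda>k. ennreal (2 ^ k * crossing_probability \<nu> (2 * pi / 2 ^ k)) * ?A
        = (\<integral>\<^sup>+ v. ?s k v \<partial>sphere_area \<nu>)) sequentially"
      using eventually_ge_at_top[of 2] by eventually_elim (simp only: nn_integral_sign_changes[OF \<nu>])
    ultimately show "(\<lambda>k. \<integral>\<^sup>+ v. ?s k v \<partial>sphere_area \<nu>) \<longlonglongrightarrow> ennreal ?L * ?A"
      by (rule Lim_transform_eventually)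
  qed
  finally show ?thesis
    using A by (simp add: expected_critical_points_def mult_divide_eq_ennreal)
qed

section \<open>Asymptotics\<close>

lemma sum_fourth_powers_over_squares:
  assumes "\<nu> \<ge> 1"
  shows "(\<Sum>m=1..\<nu>. real m ^ 4) / (\<Sum>m=1..\<nu>. real m ^ 2) = (3 * real \<nu> ^ 2 + 3 * real \<nu> - 1) / 5"
proof -
  have 2: "(\<Sum>m=1..n. real m ^ 2) = real n * (real n + 1) * (2 * real n + 1) / 6" for n
    by (induction n) (simp_all add: field_simps power2_eq_square)
  have 4: "(\<Sum>m=1..n. real m ^ 4)
      = real n * (real n + 1) * (2 * real n + 1) / 6 * ((3 * real n ^ 2 + 3 * real n - 1) / 5)" for n
    by (induction n) (simp_all add: field_simps power2_eq_square power4_eq_xxxx)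
  have "real \<nu> * (real \<nu> + 1) * (2 * real \<nu> + 1) / 6 \<noteq> 0" using assms by simp
  then show ?thesis unfolding 2 4 by (rule nonzero_mult_div_cancel_left)
qed

theorem corollary5p2:
  shows "asymp_equiv (\<lambda>\<nu>. enn2real (expected_critical_points \<nu>)) at_top
           (\<lambda>\<nu>. 2 * real \<nu> * sqrt (3/5)) \<and>
         asymp_equiv (\<lambda>\<nu>. 2 * real \<nu> * sqrt (3/5)) at_top
           (\<lambda>\<nu>. sqrt (3/5) * real (fun_space.dim (trig_space \<nu>)))"
proof
  have "eventually (\<lambda>\<nu>. enn2real (expected_critical_points \<nu>)
      = 2 * sqrt ((3 * real \<nu> ^ 2 + 3 * real \<nu> - 1) / 5)) at_top"
    using eventually_ge_at_top[of 1]
  proof eventually_elim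
    case (elim \<nu>)
    then have "1 \<le> real \<nu>" by simp
    moreover have "0 \<le> real \<nu> ^ 2" by simp
    ultimately have "0 \<le> 3 * real \<nu> ^ 2 + 3 * real \<nu> - 1" by linarith
    then show ?case
      unfolding expected_critical_points_eq[OF elim] sum_fourth_powers_over_squares[OF elim]
      by simp
  qed
  moreover have "asymp_equiv (\<lambda>\<nu>. 2 * sqrt ((3 * real \<nu> ^ 2 + 3 * real \<nu> - 1) / 5)) at_top
      (\<lambda>\<nu>. 2 * real \<nu> * sqrt (3/5))"
  proof (rule asymp_equivI')
    have "(\<lambda>\<nu>. sqrt (1 + 1 / real \<nu> - 1 / (3 * real \<nu> ^ 2))) \<longlonglongrightarrow> 1" by real_asymp
    moreover have "eventually (\<lambda>\<nu>. sqrt (1 + 1 / real \<nu> - 1 / (3 * real \<nu> ^ 2))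
        = 2 * sqrt ((3 * real \<nu> ^ 2 + 3 * real \<nu> - 1) / 5) / (2 * real \<nu> * sqrt (3/5))) at_top"
      using eventually_gt_at_top[of 0]
    proof eventually_elim
      case (elim \<nu>)
      have "(3 * real \<nu> ^ 2 + 3 * real \<nu> - 1) / 5
          = (1 + 1 / real \<nu> - 1 / (3 * real \<nu> ^ 2)) * (real \<nu> ^ 2 * (3/5))"
        using elim by (simp add: field_simps power2_eq_square)
      then have "sqrt ((3 * real \<nu> ^ 2 + 3 * real \<nu> - 1) / 5)
          = sqrt (1 + 1 / real \<nu> - 1 / (3 * real \<nu> ^ 2)) * (real \<nu> * sqrt (3/5))"
        by (simp only: real_sqrt_mult real_sqrt_abs abs_of_nat)
      then show ?case using elim by simp
    qed
    ultimately show "(\<lambda>\<nu>. 2 * sqrt ((3 * real \<nu> ^ 2 + 3 * real \<nu> - 1) / 5) / (2 * real \<nu> * sqrt (3/5))) \<longlonglongrightarrow> 1"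
      by (rule Lim_transform_eventually)
  qed
  ultimately show "asymp_equiv (\<lambda>\<nu>. enn2real (expected_critical_points \<nu>)) at_top
      (\<lambda>\<nu>. 2 * real \<nu> * sqrt (3/5))"
    by (rule asymp_equiv_trans[OF asymp_equiv_refl_ev])
  show "asymp_equiv (\<lambda>\<nu>. 2 * real \<nu> * sqrt (3/5)) at_top
      (\<lambda>\<nu>. sqrt (3/5) * real (fun_space.dim (trig_space \<nu>)))"
    unfolding dim_trig_space by real_asymp
qed

end
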